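(* Let $A$ be a finite alphabet, let $M_A$ be the free inverse monoid on $A$, and let $\varphi$ be a monoid endomorphism of $M_A$ such that the induced endomorphism $\overline{\varphi}$ of the free group $F_A$ is injective and its continuous extension $\widehat{\varphi}:\widehat{F_A}\to\widehat{F_A}$ satisfies $\mathrm{Fix}(\widehat{\varphi})=\{1\}$. Then the following conditions are equivalent: (i) $\mathrm{Fix}(\varphi)$ is context-free; (ii) $\mathrm{Fix}(\varphi)$ is rational; (iii) $\mathrm{Fix}(\varphi)$ is finitely generated; (iv) $\mathrm{Fix}(\varphi)$ is finite; (v) $\mathrm{Per}(\varphi)$ is finite; (vi) $\mathrm{Per}(\varphi)\subseteq E(M_A)$.
   Context: Let $A^{-1}$ be a set of formal inverses of $A$, $\widetilde{A}=A\cup A^{-1}$, and extend $a\mapsto a^{-1}$ to an involution on the free monoid $\widetilde{A}^*$ by $1^{-1}=1$, $(a^{-1})^{-1}=a$, $(uv)^{-1}=v^{-1}u^{-1}$. The free inverse monoid $M_A$ is the quotient of $\widetilde{A}^*$ by the congruence generated by $\{(uu^{-1}u,u)\mid u\in\widetilde{A}^*\}\cup\{(uu^{-1}vv^{-1},vv^{-1}uu^{-1})\mid u,v\in\widetilde{A}^*\}$, and $\pi:\widetilde{A}^*\to M_A$ is the canonical homomorphism. $E(M_A)$ is the set of idempotents of $M_A$. $F_A$ is the free group on $A$ and $\sigma':M_A\to F_A$ is the canonical homomorphism. Maps are written on the right. Any endomorphism $\varphi$ of $M_A$ induces a well-defined endomorphism $\overline{\varphi}$ of $F_A$: if $g=u\sigma'$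 with $u\in M_A$, then $g\overline{\varphi}=u\varphi\sigma'$. For an endomorphism $\psi$ of a monoid $M$, $\mathrm{Fix}(\psi)=\{x\in M: x\psi=x\}$ and $\mathrm{Per}(\psi)=\bigcup_{n\ge 1}\mathrm{Fix}(\psi^n)$, which are submonoids of $M$; finitely generated means finitely generated as a submonoid. A subset $X\subseteq M_A$ is rational (respectively context-free) if $X=L\pi$ for some rational (respectively context-free) language $L\subseteq\widetilde{A}^*$. Boundary: elements of $F_A$ are identified with reduced words over $\widetilde{A}$. For $u,v\in F_A$, let $r(u,v)$ be the length of the longest common prefix of the reduced words $u,v$ if $u\ne v$, and $r(u,v)=+\infty$ if $u=v$; the prefix metric is $d(u,v)=2^{-r(u,v)}$ (with $2^{-\infty}=0$). The completion $\widehat{F_A}$ of $(F_A,d)$ is obtained by adding to $F_A$ all right-infinite reduced words over $\widetilde{A}$, with the metric described in the same way. Every injective endomorphism $\theta$ of $F_A$ is uniformly continuous for $d$ and so has a unique continuous extension $\widehat{\theta}:\widehat{F_A}\to\widehat{F_A}$. When $\overline{\varphi}$ is injective, $\widehat{\varphi}$ denotes the continuous extension of $\overline{\varphi}$, and $\mathrm{Fix}(\widehat{\varphi})=\{\alpha\in\widehat{F_A}:\alpha\widehat{\varphi}=\alpha\}$; here $1$ is the identity of $F_A$ (the empty word). *)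

theory Defs
  imports "HOL-Algebra.Group" "HOL-Analysis.Abstract_Metric_Spaces" "HOL-Library.Sublist"
begin

section \<open>Words over an alphabet with formal inverses\<close>

text \<open>The pair \<open>(a, True)\<close> stands for the letter $a$ and \<open>(a, False)\<close> for $a^{-1}$.\<close>

type_synonym 'a letter = "'a \<times> bool"
type_synonym 'a word = "'a letter list"

definition letters :: "'a set \<Rightarrow> 'a letter set" where
  "letters A = A \<times> UNIV"

definition linv :: "'a letter \<Rightarrow> 'a letter" where
  "linv x = (fst x, \<not> snd x)"

definition winv :: "'a word \<Rightarrow> 'a word" where
  "winv w = rev (map linv w)"

lemma linv_linv [simp]: "linv (linv x) = x"
  by (simp add: linv_def)

lemma linv_neq [simp]: "linv x \<noteq> x" "x \<noteq> linv x"
  by (auto simp: linv_def prod_eq_iff)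

lemma linv_in_letters [simp]: "linv x \<in> letters A \<longleftrightarrow> x \<in> letters A"
  by (auto simp: linv_def letters_def mem_Times_iff)

lemma winv_simps [simp]:
  "winv [] = []" "winv (winv w) = w" "winv (u @ v) = winv v @ winv u"
  by (simp_all add: winv_def rev_map o_def)

lemma winv_in_lists [simp]: "winv w \<in> lists (letters A) \<longleftrightarrow> w \<in> lists (letters A)"
  by (auto simp: winv_def in_lists_conv_set)


section \<open>The free inverse monoid\<close>

inductive fim_eq :: "'a set \<Rightarrow> 'a word \<Rightarrow> 'a word \<Rightarrow> bool" for A where
  inverse: "u \<in> lists (letters A) \<Longrightarrow> fim_eq A (u @ winv u @ u) u"
| commute: "u \<in> lists (letters A) \<Longrightarrow> v \<in> lists (letters A) \<Longrightarrow>
     fim_eq A (u @ winv u @ v @ winv v) (v @ winv v @ u @ winv u)"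
| refl: "u \<in> lists (letters A) \<Longrightarrow> fim_eq A u u"
| sym: "fim_eq A u v \<Longrightarrow> fim_eq A v u"
| trans: "fim_eq A u v \<Longrightarrow> fim_eq A v w \<Longrightarrow> fim_eq A u w"
| append: "fim_eq A u v \<Longrightarrow> fim_eq A u' v' \<Longrightarrow> fim_eq A (u @ u') (v @ v')"

text \<open>\<open>fim_class A\<close> is the canonical homomorphism $\pi$ onto the quotient monoid.\<close>

definition fim_rel :: "'a set \<Rightarrow> ('a word \<times> 'a word) set" where
  "fim_rel A = {(u, v). fim_eq A u v}"

definition fim_class :: "'a set \<Rightarrow> 'a word \<Rightarrow> 'a word set" where
  "fim_class A u = fim_rel A `` {u}"

definition FIM :: "'a set \<Rightarrow> 'a word set monoid" where
  "FIM A = \<lparr>carrier = lists (letters A) // fim_rel A,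
     mult = (\<lambda>X Y. \<Union>x\<in>X. \<Union>y\<in>Y. fim_class A (x @ y)),
     one = fim_class A []\<rparr>"

lemma fim_eq_lists: "fim_eq A u v \<Longrightarrow> u \<in> lists (letters A) \<and> v \<in> lists (letters A)"
  by (induction rule: fim_eq.induct) auto

lemma equiv_fim_rel: "equiv (lists (letters A)) (fim_rel A)"
proof (rule equivI)
  show "fim_rel A \<subseteq> lists (letters A) \<times> lists (letters A)"
    unfolding fim_rel_def using fim_eq_lists by blast
  show "refl_on (lists (letters A)) (fim_rel A)"
    unfolding fim_rel_def refl_on_def using fim_eq.refl by blast
  show "sym (fim_rel A)"
    unfolding fim_rel_def using fim_eq.sym by (blast intro: symI)
  show "trans (fim_rel A)"
    unfolding fim_rel_def using fim_eq.trans by (blast intro: transI)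
qed

lemma fim_class_eq_iff:
  "u \<in> lists (letters A) \<Longrightarrow> v \<in> lists (letters A) \<Longrightarrow>
     fim_class A u = fim_class A v \<longleftrightarrow> fim_eq A u v"
  using eq_equiv_class_iff[OF equiv_fim_rel, of u A v]
  by (simp add: fim_class_def fim_rel_def)

lemma carrier_FIM: "carrier (FIM A) = fim_class A ` lists (letters A)"
  by (auto simp: FIM_def fim_class_def quotient_def)

lemma one_FIM: "\<one>\<^bsub>FIM A\<^esub> = fim_class A []"
  by (simp add: FIM_def)

lemma mult_FIM:
  assumes "u \<in> lists (letters A)" "v \<in> lists (letters A)"
  shows "fim_class A u \<otimes>\<^bsub>FIM A\<^esub> fim_class A v = fim_class A (u @ v)"
proof -
  have "fim_class A (x @ y) = fim_class A (u @ v)"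
    if "x \<in> fim_class A u" "y \<in> fim_class A v" for x y
  proof -
    have "fim_eq A u x" "fim_eq A v y"
      using that by (auto simp: fim_class_def fim_rel_def)
    then have e: "fim_eq A (u @ v) (x @ y)" by (rule fim_eq.append)
    then show ?thesis
      using fim_eq_lists[OF e] fim_class_eq_iff by metis
  qed
  moreover have "u \<in> fim_class A u" "v \<in> fim_class A v"
    using assms by (simp_all add: fim_class_def fim_rel_def fim_eq.refl)
  ultimately have "(\<Union>x\<in>fim_class A u. \<Union>y\<in>fim_class A v. fim_class A (x @ y)) = fim_class A (u @ v)"
    by blast
  then show ?thesis by (simp add: FIM_def)
qed

lemma monoid_FIM: "monoid (FIM A)"
proof (rule monoidI)
  show "\<And>x y. x \<in> carrier (FIM A) \<Longrightarrow> y \<in> carrier (FIM A) \<Longrightarrow>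
      x \<otimes>\<^bsub>FIM A\<^esub> y \<in> carrier (FIM A)"
    unfolding carrier_FIM by (smt (verit) append_in_lists_conv image_iff mult_FIM)
  show "\<one>\<^bsub>FIM A\<^esub> \<in> carrier (FIM A)"
    by (auto simp: carrier_FIM one_FIM)
next
  fix x y z assume "x \<in> carrier (FIM A)" "y \<in> carrier (FIM A)" "z \<in> carrier (FIM A)"
  then obtain u v w where "x = fim_class A u" "y = fim_class A v" "z = fim_class A w"
    "u \<in> lists (letters A)" "v \<in> lists (letters A)" "w \<in> lists (letters A)"
    unfolding carrier_FIM by blast
  then show "x \<otimes>\<^bsub>FIM A\<^esub> y \<otimes>\<^bsub>FIM A\<^esub> z = x \<otimes>\<^bsub>FIM A\<^esub> (y \<otimes>\<^bsub>FIM A\<^esub> z)"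
    by (simp add: mult_FIM)
next
  fix x assume "x \<in> carrier (FIM A)"
  then obtain u where "x = fim_class A u" "u \<in> lists (letters A)"
    unfolding carrier_FIM by blast
  then show "\<one>\<^bsub>FIM A\<^esub> \<otimes>\<^bsub>FIM A\<^esub> x = x" "x \<otimes>\<^bsub>FIM A\<^esub> \<one>\<^bsub>FIM A\<^esub> = x"
    using mult_FIM[of "[]" A u] mult_FIM[of u A "[]"] by (simp_all add: one_FIM)
qed

definition idempotents :: "('m, 'b) monoid_scheme \<Rightarrow> 'm set" where
  "idempotents M = {e \<in> carrier M. e \<otimes>\<^bsub>M\<^esub> e = e}"


section \<open>The free group, as reduced words\<close>

definition reduced :: "'a word \<Rightarrow> bool" where
  "reduced w \<longleftrightarrow> successively (\<lambda>x y. y \<noteq> linv x) w"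

fun cons_reduce :: "'a letter \<Rightarrow> 'a word \<Rightarrow> 'a word" where
  "cons_reduce x [] = [x]"
| "cons_reduce x (y # w) = (if y = linv x then w else x # y # w)"

definition reduce :: "'a word \<Rightarrow> 'a word" where
  "reduce w = foldr cons_reduce w []"

definition FG :: "'a set \<Rightarrow> 'a word monoid" where
  "FG A = \<lparr>carrier = {w \<in> lists (letters A). reduced w},
     mult = (\<lambda>u v. reduce (u @ v)), one = []\<rparr>"

lemma reduced_Nil [simp]: "reduced []"
  by (simp add: reduced_def)

lemma reduced_cons_reduce: "reduced w \<Longrightarrow> reduced (cons_reduce x w)"
  by (cases w rule: remdups_adj.cases) (auto simp: reduced_def)

lemma reduced_foldr: "reduced w \<Longrightarrow> reduced (foldr cons_reduce u w)"
  by (induction u) (auto intro: reduced_cons_reduce)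

lemma reduced_reduce [simp]: "reduced (reduce w)"
  by (simp add: reduce_def reduced_foldr)

lemma reduce_reduced: "reduced w \<Longrightarrow> reduce w = w"
proof (induction w)
  case (Cons x w)
  then show ?case by (cases w) (auto simp: reduced_def reduce_def)
qed (simp add: reduce_def)

lemma reduce_in_lists: "w \<in> lists S \<Longrightarrow> reduce w \<in> lists S"
proof (induction w)
  case (Cons x w)
  have "cons_reduce x v \<in> lists S" if "v \<in> lists S" "x \<in> S" for v
    using that by (cases v) auto
  then show ?case using Cons by (auto simp: reduce_def)
qed (simp add: reduce_def)

lemma cons_reduce_linv: "reduced w \<Longrightarrow> cons_reduce x (cons_reduce (linv x) w) = w"
  by (cases w rule: remdups_adj.cases) (auto simp: reduced_def)

lemma foldr_winv: "reduced w \<Longrightarrow> foldr cons_reduce u (foldr cons_reduce (winv u) w) = w"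
proof (induction u arbitrary: w)
  case (Cons x u)
  then show ?case
    by (simp add: winv_def reduced_cons_reduce cons_reduce_linv)
qed (simp add: winv_def)

lemma foldr_reduce: "reduced w \<Longrightarrow> foldr cons_reduce (reduce u) w = foldr cons_reduce u w"
proof (induction u)
  case (Cons x u)
  have "foldr cons_reduce (cons_reduce x v) w = cons_reduce x (foldr cons_reduce v w)" for v
    using cons_reduce_linv[OF reduced_foldr[OF Cons.prems]] by (cases v) auto
  then show ?case using Cons by (simp add: reduce_def)
qed (simp add: reduce_def)

lemma reduce_append: "reduce (reduce u @ v) = reduce (u @ v)" "reduce (u @ reduce v) = reduce (u @ v)"
  using foldr_reduce[of "foldr cons_reduce v []" u] foldr_reduce[of "[]" v]
  by (simp_all add: reduce_def reduced_foldr)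

lemma reduce_winv: "reduce (u @ winv u) = []" "reduce (winv u @ u) = []"
  using foldr_winv[of "[]" u] foldr_winv[of "[]" "winv u"] by (simp_all add: reduce_def)

lemma reduce_in_carrier: "w \<in> lists (letters A) \<Longrightarrow> reduce w \<in> carrier (FG A)"
  by (simp add: FG_def reduce_in_lists)

lemma group_FG: "group (FG A)"
proof (rule groupI)
  fix x assume x: "x \<in> carrier (FG A)"
  then have "reduce (winv x) \<in> carrier (FG A)"
    by (intro reduce_in_carrier) (simp add: FG_def)
  moreover have "reduce (winv x) \<otimes>\<^bsub>FG A\<^esub> x = \<one>\<^bsub>FG A\<^esub>"
    by (simp add: FG_def reduce_append reduce_winv)
  ultimately show "\<exists>y\<in>carrier (FG A). y \<otimes>\<^bsub>FG A\<^esub> x = \<one>\<^bsub>FG A\<^esub>" by blast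
next
  fix x y assume "x \<in> carrier (FG A)" "y \<in> carrier (FG A)"
  then have "reduce (x @ y) \<in> carrier (FG A)"
    by (intro reduce_in_carrier) (simp add: FG_def)
  then show "x \<otimes>\<^bsub>FG A\<^esub> y \<in> carrier (FG A)"
    by (simp add: FG_def)
qed (simp_all add: FG_def reduce_append reduce_reduced)

lemma fim_eq_imp_reduce_eq: "fim_eq A u v \<Longrightarrow> reduce u = reduce v"
proof -
  have "fim_eq A u v \<Longrightarrow> reduced w \<Longrightarrow> foldr cons_reduce u w = foldr cons_reduce v w" for w
    by (induction arbitrary: w rule: fim_eq.induct)
       (simp_all add: foldr_winv reduced_foldr)
  from this[of "[]"] show "fim_eq A u v \<Longrightarrow> reduce u = reduce v"
    by (simp add: reduce_def)
qed

text \<open>The canonical homomorphism from the free inverse monoid to the free group: all words in a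
  class have the same reduced form.\<close>

definition fim_to_fg :: "'a word set \<Rightarrow> 'a word" where
  "fim_to_fg X = the_elem (reduce ` X)"

lemma fim_to_fg_class:
  assumes "u \<in> lists (letters A)"
  shows "fim_to_fg (fim_class A u) = reduce u"
proof -
  have "\<forall>v\<in>fim_class A u. reduce v = reduce u"
    by (simp add: fim_class_def fim_rel_def) (metis fim_eq_imp_reduce_eq)
  moreover have "u \<in> fim_class A u"
    using assms by (simp add: fim_class_def fim_rel_def fim_eq.refl)
  ultimately have "reduce ` fim_class A u = {reduce u}"
    by blast
  then show ?thesis by (simp add: fim_to_fg_def)
qed

lemma fim_to_fg_hom: "fim_to_fg \<in> hom (FIM A) (FG A)"
proof (rule homI)
  fix x assume "x \<in> carrier (FIM A)"
  then show "fim_to_fg x \<in> carrier (FG A)"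
    unfolding carrier_FIM using fim_to_fg_class reduce_in_carrier by (metis imageE)
next
  fix x y assume "x \<in> carrier (FIM A)" "y \<in> carrier (FIM A)"
  then obtain u v where "x = fim_class A u" "y = fim_class A v"
    "u \<in> lists (letters A)" "v \<in> lists (letters A)"
    unfolding carrier_FIM by blast
  then show "fim_to_fg (x \<otimes>\<^bsub>FIM A\<^esub> y) = fim_to_fg x \<otimes>\<^bsub>FG A\<^esub> fim_to_fg y"
    by (simp add: mult_FIM fim_to_fg_class reduce_append FG_def)
qed

text \<open>The value at $g$ is the image of $u\varphi$ in the free group, for any $u$ in the free
  inverse monoid lying over $g$; independence of $u$ is part of \<open>fg_induced_reduce\<close> below.\<close>

definition fg_induced :: "'a set \<Rightarrow> ('a word set \<Rightarrow> 'a word set) \<Rightarrow> 'a word \<Rightarrow> 'a word" where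
  "fg_induced A \<phi> g = the_elem {fim_to_fg (\<phi> u) | u. u \<in> carrier (FIM A) \<and> fim_to_fg u = g}"


lemma fg_induced_reduce:
  assumes \<phi>: "\<phi> \<in> hom (FIM A) (FIM A)" "\<phi> \<one>\<^bsub>FIM A\<^esub> = \<one>\<^bsub>FIM A\<^esub>"
    and u: "u \<in> lists (letters A)"
  shows "fg_induced A \<phi> (reduce u) = fim_to_fg (\<phi> (fim_class A u))"
proof -
  interpret F: group "FG A" by (rule group_FG)
  define f where "f w = fim_to_fg (\<phi> (fim_class A w))" for w
  have cl: "fim_class A w \<in> carrier (FIM A)" if "w \<in> lists (letters A)" for w
    using that by (auto simp: carrier_FIM)
  have f_in: "f w \<in> carrier (FG A)" if "w \<in> lists (letters A)" for w
    using cl[OF that] \<phi>(1) fim_to_fg_hom unfolding f_def hom_def by blast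
  have f_app: "f (v @ w) = f v \<otimes>\<^bsub>FG A\<^esub> f w"
    if "v \<in> lists (letters A)" "w \<in> lists (letters A)" for v w
    using cl[OF that(1)] cl[OF that(2)] hom_mult[OF \<phi>(1)] hom_mult[OF fim_to_fg_hom]
      hom_in_carrier[OF \<phi>(1)] mult_FIM[OF that] unfolding f_def by metis
  have f_Nil: "f [] = \<one>\<^bsub>FG A\<^esub>"
    using \<phi>(2) fim_to_fg_class[of "[]" A] by (simp add: f_def one_FIM FG_def reduce_def)
  have f_cancel: "f [x, linv x] = \<one>\<^bsub>FG A\<^esub>" if "x \<in> letters A" for x
  proof -
    have l: "[x] \<in> lists (letters A)" "[linv x] \<in> lists (letters A)" "[x, linv x] \<in> lists (letters A)"
      using that by auto
    have "fim_eq A ([x, linv x] @ [x]) [x]"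
      using fim_eq.inverse[OF l(1)] by (simp add: winv_def)
    then have "f ([x, linv x] @ [x]) = f [x]"
      using fim_class_eq_iff fim_eq_lists unfolding f_def by metis
    then show ?thesis
      using f_app[OF l(3,1)] f_in[OF l(1)] f_in[OF l(3)] F.r_cancel_one' by metis
  qed
  have f_reduce: "w \<in> lists (letters A) \<Longrightarrow> f (reduce w) = f w" for w
  proof (induction w)
    case (Cons x w)
    have x: "x \<in> letters A" "[x] \<in> lists (letters A)" and w: "w \<in> lists (letters A)"
      using Cons.prems by simp_all
    have "f (cons_reduce x v) = f ([x] @ v)" if v: "v \<in> lists (letters A)" for v
    proof (cases "\<exists>v'. v = linv x # v'")
      case True
      then obtain v' where v': "v = linv x # v'" by blast
      then have "v' \<in> lists (letters A)" "[x, linv x] \<in> lists (letters A)" using v x by auto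
      then have "f ([x, linv x] @ v') = f v'"
        using f_app[of "[x, linv x]" v'] f_cancel[OF x(1)] F.l_one[OF f_in[of v']] by simp
      then show ?thesis using v' by simp
    next
      case False
      then show ?thesis by (cases v) auto
    qed
    from this[OF reduce_in_lists[OF w]] have "f (reduce (x # w)) = f ([x] @ reduce w)"
      by (simp add: reduce_def)
    then show ?case
      using Cons.IH[OF w] f_app[OF x(2) w] f_app[OF x(2) reduce_in_lists[OF w]] by simp
  qed (simp add: reduce_def)
  have "{fim_to_fg (\<phi> X) | X. X \<in> carrier (FIM A) \<and> fim_to_fg X = reduce u} = {f u}"
  proof -
    have "fim_to_fg (\<phi> X) = f u" if X: "X \<in> carrier (FIM A)" "fim_to_fg X = reduce u" for X
    proof -
      obtain w where w: "X = fim_class A w" "w \<in> lists (letters A)"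
        using X(1) unfolding carrier_FIM by blast
      then have "reduce w = reduce u" using X(2) fim_to_fg_class by metis
      then show ?thesis using f_reduce[OF w(2)] f_reduce[OF u] w(1) by (simp add: f_def)
    qed
    moreover have "fim_to_fg (fim_class A u) = reduce u" "f u = fim_to_fg (\<phi> (fim_class A u))"
      using fim_to_fg_class[OF u] by (simp_all add: f_def)
    ultimately show ?thesis using cl[OF u] by blast
  qed
  then show ?thesis by (simp add: fg_induced_def f_def)
qed


section \<open>The completion of the free group\<close>

datatype 'a bword = FinWord "'a word" | InfWord "nat \<Rightarrow> 'a letter"

text \<open>The reduced words over the letters of \<open>A\<close> and their inverses, finite or right-infinite.\<close>

definition FG_hat :: "'a set \<Rightarrow> 'a bword set" where
  "FG_hat A = FinWord ` carrier (FG A) \<union>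
     InfWord ` {f. (\<forall>i. f i \<in> letters A) \<and> (\<forall>i. f (Suc i) \<noteq> linv (f i))}"

fun prefix_of :: "'a word \<Rightarrow> 'a bword \<Rightarrow> bool" where
  "prefix_of p (FinWord w) \<longleftrightarrow> prefix p w"
| "prefix_of p (InfWord f) \<longleftrightarrow> (\<forall>i<length p. p ! i = f i)"

definition lcp_length :: "'a bword \<Rightarrow> 'a bword \<Rightarrow> nat" where
  "lcp_length x y = Max {length p | p. prefix_of p x \<and> prefix_of p y}"

definition prefix_dist :: "'a bword \<Rightarrow> 'a bword \<Rightarrow> real" where
  "prefix_dist x y = (if x = y then 0 else (1/2) ^ lcp_length x y)"

lemma prefix_of_imp_prefix:
  "prefix_of p x \<Longrightarrow> prefix_of q x \<Longrightarrow> length p \<le> length q \<Longrightarrow> prefix p q"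
proof (cases x)
  case (InfWord f)
  assume "prefix_of p x" "prefix_of q x" "length p \<le> length q"
  then have "p = take (length p) q"
    using InfWord by (intro nth_equalityI) auto
  then show ?thesis by (metis take_is_prefix)
qed (auto intro: prefix_length_prefix)

lemma prefix_of_mono: "prefix p q \<Longrightarrow> prefix_of q x \<Longrightarrow> prefix_of p x"
proof (cases x)
  case (InfWord f)
  assume "prefix p q" "prefix_of q x"
  moreover from this(1) have "\<forall>i<length p. i < length q \<and> p ! i = q ! i"
    by (auto simp: prefix_def nth_append)
  ultimately show ?thesis using InfWord by auto
qed auto

lemma finite_common_prefixes:
  assumes "x \<noteq> y"
  shows "finite {length p | p. prefix_of p x \<and> prefix_of p y}"
proof -
  have "\<exists>N. \<forall>p. prefix_of p x \<longrightarrow> prefix_of p y \<longrightarrow> length p \<le> N"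
  proof (cases "\<exists>w. x = FinWord w \<or> y = FinWord w")
    case True
    then obtain w where "x = FinWord w \<or> y = FinWord w" by blast
    then show ?thesis using prefix_length_le by (intro exI[of _ "length w"]) auto
  next
    case False
    then obtain f g where fg: "x = InfWord f" "y = InfWord g" by (metis bword.exhaust)
    then obtain i where "f i \<noteq> g i" using assms by auto
    then show ?thesis using fg by (intro exI[of _ i]) (metis not_le prefix_of.simps(2))
  qed
  then obtain N where "\<forall>p. prefix_of p x \<longrightarrow> prefix_of p y \<longrightarrow> length p \<le> N" by blast
  then have "{length p | p. prefix_of p x \<and> prefix_of p y} \<subseteq> {..N}" by auto
  then show ?thesis using finite_subset by blast
qed

lemma length_le_lcp: "x \<noteq> y \<Longrightarrow> prefix_of p x \<Longrightarrow> prefix_of p y \<Longrightarrow> length p \<le> lcp_length x y"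
  unfolding lcp_length_def by (rule Max_ge[OF finite_common_prefixes]) auto

lemma lcp_witness:
  assumes "x \<noteq> y"
  obtains p where "prefix_of p x" "prefix_of p y" "length p = lcp_length x y"
proof -
  have "prefix_of [] x \<and> prefix_of [] y" by (cases x; cases y) auto
  then have "{length p | p. prefix_of p x \<and> prefix_of p y} \<noteq> {}" by blast
  from Max_in[OF finite_common_prefixes[OF assms] this] show ?thesis
    using that unfolding lcp_length_def by auto
qed

lemma lcp_ultrametric:
  assumes "x \<noteq> y" "y \<noteq> z" "x \<noteq> z"
  shows "min (lcp_length x y) (lcp_length y z) \<le> lcp_length x z"
proof -
  obtain p where p: "prefix_of p x" "prefix_of p y" "length p = lcp_length x y"
    using lcp_witness[OF assms(1)] .
  obtain q where q: "prefix_of q y" "prefix_of q z" "length q = lcp_length y z"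
    using lcp_witness[OF assms(2)] .
  show ?thesis
  proof (cases "length p \<le> length q")
    case True
    then have "prefix_of p z"
      using prefix_of_imp_prefix[OF p(2) q(1)] prefix_of_mono q(2) by blast
    then show ?thesis using length_le_lcp[OF assms(3) p(1)] p by linarith
  next
    case False
    then have "prefix_of q x"
      using prefix_of_imp_prefix[OF q(1) p(2)] prefix_of_mono p(1) by (meson nle_le)
    then show ?thesis using length_le_lcp[OF assms(3) _ q(2)] q by fastforce
  qed
qed

lemma Metric_space_FG_hat: "Metric_space (FG_hat A) prefix_dist"
proof
  show "0 \<le> prefix_dist x y" for x y :: "'a bword" by (simp add: prefix_dist_def)
  show "prefix_dist x y = prefix_dist y x" for x y :: "'a bword"
    by (simp add: prefix_dist_def lcp_length_def conj_commute)
  show "prefix_dist x y = 0 \<longleftrightarrow> x = y" for x y :: "'a bword"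
    by (simp add: prefix_dist_def)
  show "prefix_dist x z \<le> prefix_dist x y + prefix_dist y z" for x y z :: "'a bword"
  proof (cases "x = y \<or> y = z \<or> x = z")
    case False
    have "((1::real)/2) ^ lcp_length x z \<le> (1/2) ^ min (lcp_length x y) (lcp_length y z)"
      using lcp_ultrametric[of x y z] False by (intro power_decreasing) auto
    also have "\<dots> \<le> (1/2) ^ lcp_length x y + (1/2) ^ lcp_length y z"
      by (simp add: min_def)
    finally show ?thesis using False by (simp add: prefix_dist_def)
  qed (auto simp: prefix_dist_def)
qed

definition FG_hat_top :: "'a set \<Rightarrow> 'a bword topology" where
  "FG_hat_top A = Metric_space.mtopology (FG_hat A) prefix_dist"

text \<open>There is at most one such \<open>\<theta>'\<close> on the completion, see \<open>continuous_extension_unique\<close>; its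
  values outside the completion are irrelevant.\<close>

definition continuous_extension ::
  "'a set \<Rightarrow> ('a word \<Rightarrow> 'a word) \<Rightarrow> ('a bword \<Rightarrow> 'a bword) \<Rightarrow> bool" where
  "continuous_extension A \<theta> \<theta>' \<longleftrightarrow>
     continuous_map (FG_hat_top A) (FG_hat_top A) \<theta>' \<and>
     (\<forall>g\<in>carrier (FG A). \<theta>' (FinWord g) = FinWord (\<theta> g))"


lemma topspace_FG_hat_top: "topspace (FG_hat_top A) = FG_hat A"
  unfolding FG_hat_top_def by (rule Metric_space.topspace_mtopology[OF Metric_space_FG_hat])

lemma FG_hat_dense: "FG_hat_top A closure_of (FinWord ` carrier (FG A)) = FG_hat A"
proof -
  interpret Metric_space "FG_hat A" prefix_dist by (rule Metric_space_FG_hat)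
  have "\<exists>y\<in>FinWord ` carrier (FG A). y \<in> mball x r" if x: "x \<in> FG_hat A" and r: "r > 0" for x r
  proof (cases x)
    case (FinWord w)
    have "x \<in> mball x r" using x r by simp
    moreover have "x \<in> FinWord ` carrier (FG A)" using x FinWord by (auto simp: FG_hat_def)
    ultimately show ?thesis by blast
  next
    case (InfWord f)
    obtain n where n: "(1/2::real) ^ n < r"
      using real_arch_pow_inv[OF r, of "1/2"] by auto
    let ?w = "map f [0..<n]"
    have f: "\<forall>i. f i \<in> letters A" "\<forall>i. f (Suc i) \<noteq> linv (f i)"
      using x InfWord by (auto simp: FG_hat_def)
    then have w: "?w \<in> carrier (FG A)"
      by (auto simp: FG_def reduced_def successively_conv_nth)
    have "prefix_of ?w x" "prefix_of ?w (FinWord ?w)" by (auto simp: InfWord)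
    then have "n \<le> lcp_length x (FinWord ?w)"
      using length_le_lcp[of x "FinWord ?w" ?w] InfWord by simp
    then have "(1/2::real) ^ lcp_length x (FinWord ?w) \<le> (1/2) ^ n"
      by (intro power_decreasing) auto
    moreover have "prefix_dist x (FinWord ?w) = (1/2) ^ lcp_length x (FinWord ?w)"
      using InfWord by (simp add: prefix_dist_def)
    ultimately have "prefix_dist x (FinWord ?w) < r"
      using n by linarith
    moreover have "FinWord ?w \<in> FG_hat A" using w by (simp add: FG_hat_def)
    ultimately have "FinWord ?w \<in> mball x r" using x by simp
    then show ?thesis using w by blast
  qed
  then show ?thesis unfolding FG_hat_top_def metric_closure_of by blast
qed

lemma continuous_extension_unique:
  assumes "continuous_extension A \<theta> f" "continuous_extension A \<theta> g" "x \<in> FG_hat A"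
  shows "f x = g x"
proof (rule forall_in_closure_of_eq[of x "FG_hat_top A" "FinWord ` carrier (FG A)" "FG_hat_top A"])
  show "Hausdorff_space (FG_hat_top A)"
    unfolding FG_hat_top_def by (rule Metric_space.Hausdorff_space_mtopology[OF Metric_space_FG_hat])
qed (use assms in \<open>auto simp: FG_hat_dense continuous_extension_def\<close>)


section \<open>Fixed and periodic points\<close>

definition fixpoints :: "'x set \<Rightarrow> ('x \<Rightarrow> 'x) \<Rightarrow> 'x set" where
  "fixpoints X f = {x \<in> X. f x = x}"

definition perpoints :: "'x set \<Rightarrow> ('x \<Rightarrow> 'x) \<Rightarrow> 'x set" where
  "perpoints X f = (\<Union>n\<in>{1..}. fixpoints X (f ^^ n))"


section \<open>Finitely generated submonoids\<close>

inductive_set submonoid_gen :: "('m, 'b) monoid_scheme \<Rightarrow> 'm set \<Rightarrow> 'm set" for M S where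
  one: "\<one>\<^bsub>M\<^esub> \<in> submonoid_gen M S"
| incl: "x \<in> S \<Longrightarrow> x \<in> submonoid_gen M S"
| mult: "x \<in> submonoid_gen M S \<Longrightarrow> y \<in> submonoid_gen M S \<Longrightarrow> x \<otimes>\<^bsub>M\<^esub> y \<in> submonoid_gen M S"

definition fin_gen_submonoid :: "('m, 'b) monoid_scheme \<Rightarrow> 'm set \<Rightarrow> bool" where
  "fin_gen_submonoid M N \<longleftrightarrow>
     submonoid N M \<and> (\<exists>S. finite S \<and> S \<subseteq> N \<and> submonoid_gen M S = N)"


section \<open>Rational and context-free languages and subsets\<close>

inductive_set star_lang :: "'c list set \<Rightarrow> 'c list set" for L where
  Nil: "[] \<in> star_lang L"
| append: "u \<in> L \<Longrightarrow> v \<in> star_lang L \<Longrightarrow> u @ v \<in> star_lang L"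

inductive rational_lang :: "'c set \<Rightarrow> 'c list set \<Rightarrow> bool" for \<Sigma> where
  finite: "finite L \<Longrightarrow> L \<subseteq> lists \<Sigma> \<Longrightarrow> rational_lang \<Sigma> L"
| union: "rational_lang \<Sigma> K \<Longrightarrow> rational_lang \<Sigma> L \<Longrightarrow> rational_lang \<Sigma> (K \<union> L)"
| product: "rational_lang \<Sigma> K \<Longrightarrow> rational_lang \<Sigma> L \<Longrightarrow>
     rational_lang \<Sigma> {u @ v | u v. u \<in> K \<and> v \<in> L}"
| star: "rational_lang \<Sigma> L \<Longrightarrow> rational_lang \<Sigma> (star_lang L)"

text \<open>Context-free grammars have nonterminals \<open>Inl n\<close> and terminals \<open>Inr c\<close>. A finite grammar uses
  finitely many nonterminals, so natural numbers suffice as their names.\<close>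

type_synonym 'c production = "nat \<times> (nat + 'c) list"

inductive cfg_step :: "'c production set \<Rightarrow> (nat + 'c) list \<Rightarrow> (nat + 'c) list \<Rightarrow> bool" for P where
  "(n, w) \<in> P \<Longrightarrow> cfg_step P (x @ [Inl n] @ y) (x @ w @ y)"

definition cfg_lang :: "'c production set \<Rightarrow> nat \<Rightarrow> 'c set \<Rightarrow> 'c list set" where
  "cfg_lang P s \<Sigma> = {w \<in> lists \<Sigma>. (cfg_step P)\<^sup>*\<^sup>* [Inl s] (map Inr w)}"

definition context_free_lang :: "'c set \<Rightarrow> 'c list set \<Rightarrow> bool" where
  "context_free_lang \<Sigma> L \<longleftrightarrow>
     (\<exists>P s. finite P \<and> P \<subseteq> UNIV \<times> lists (UNIV <+> \<Sigma>) \<and> L = cfg_lang P s \<Sigma>)"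

definition rational_subset :: "'a set \<Rightarrow> 'a word set set \<Rightarrow> bool" where
  "rational_subset A X \<longleftrightarrow> (\<exists>L. rational_lang (letters A) L \<and> X = fim_class A ` L)"

definition context_free_subset :: "'a set \<Rightarrow> 'a word set set \<Rightarrow> bool" where
  "context_free_subset A X \<longleftrightarrow> (\<exists>L. context_free_lang (letters A) L \<and> X = fim_class A ` L)"

end

theory Submission
  imports Defs
begin

text \<open>An element of the free inverse monoid is determined by its Munn tree, the finite set of
  group elements visited by the prefixes of a representing word, together with its image in the
  free group (\<open>fim_eq_iff_munn\<close>). Write \<open>\<theta>\<close> for the induced endomorphism of the free group. If \<open>g\<close>
  is a vertex of the tree of \<open>X\<close>, then \<open>\<theta> g\<close> is a vertex of the tree of \<open>X\<phi>\<close> (\<open>tree_endo\<close>). Hence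
  the tree of a point fixed by a power of \<open>\<phi>\<close> is mapped into itself by a power of \<open>\<theta>\<close>, and since
  \<open>\<theta>\<close> is injective and the tree is finite, every vertex of it is \<open>\<theta>\<close>-periodic.

  This makes the periodic points rigid. Cutting a periodic idempotent \<open>X\<close> at a vertex \<open>g\<close> of its
  tree gives an element with the same tree and group image \<open>g\<close>, which is again periodic, and which
  is idempotent only if \<open>g = 1\<close>. So if all periodic points are idempotent, the only periodic point
  is \<open>1\<close> (\<open>per_idempotent_imp_trivial\<close>). Conversely, if \<open>X\<close> is periodic with group image \<open>g \<noteq> 1\<close>,
  then the idempotents \<open>X^k X^{-k}\<close> are periodic too, the products over their \<open>\<phi>\<close>-orbits are
  fixed, and their trees contain all the powers of \<open>g\<close>, which are distinct because the free group
  is torsion-free; so the set of fixed points is infinite (\<open>finite_fix_imp_per_idempotent\<close>).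

  It remains to see that a fixed-point set which is rational, finitely generated or context-free
  is finite. As \<open>1\<close> is the only fixed point of the extension to the completion, every fixed point
  of \<open>\<phi>\<close> is an idempotent, and a set of elements whose trees lie in one finite set is finite. For
  a finitely generated set of idempotents the trees lie in the union of the trees of the
  generators. For a rational language an induction over the rational operations bounds the trees:
  the words under a star that occurs inside words of trivial value must have trivial value
  themselves, so repeating them adds no new vertices (\<open>rational_trivial_bounded_trees\<close>).

  For a context-free language, a loop \<open>N \<Rightarrow>\<^sup>* u N v\<close> on a nonterminal could a priori have a
  nontrivial value \<open>u\<close> in the free group. Then the words \<open>x u^k z v^k y\<close> of the language have
  trees that grow along the single ray \<open>x, x u, x u^2, ...\<close>, up to a bounded distance. This is
  where the boundary enters. The ray converges to an end \<open>\<xi>\<close>; the images \<open>(x u^k)\<theta>\<close> are distinct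
  and lie in the same trees, so they stay near the same ray and also converge to \<open>\<xi>\<close>; by
  continuity \<open>\<xi>\<close> is a fixed point of the extension, a contradiction
  (\<open>pumped_fixed_points_trivial\<close>). So every loop has trivial value, only finitely many positions
  are visited by the words of the language (\<open>cfg_bounded_trees\<close>), and the fixed-point set is
  finite.\<close>

section \<open>Words and reduction\<close>

lemma reduce_cong:
  "reduce u = reduce u' \<Longrightarrow> reduce v = reduce v' \<Longrightarrow> reduce (u @ v) = reduce (u' @ v')"
  by (metis reduce_append)

lemma reduce_Nil [simp]: "reduce [] = []"
  by (simp add: reduce_def)

lemma reduce_winv_append [simp]:
  "reduce (winv u @ u @ v) = reduce v" "reduce (u @ winv u @ v) = reduce v"
  using reduce_cong[of "winv u @ u" "[]" v v] reduce_cong[of "u @ winv u" "[]" v v]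
  by (simp_all add: reduce_winv)

lemma reduce_append_winv [simp]:
  "reduce (u @ v @ winv v) = reduce u" "reduce (u @ winv v @ v) = reduce u"
  using reduce_cong[of u u "winv v @ v" "[]"] reduce_cong[of u u "v @ winv v" "[]"]
  by (simp_all add: reduce_winv)

lemma reduce_left_cancel [simp]: "reduce (x @ u) = reduce (x @ v) \<longleftrightarrow> reduce u = reduce v"
  by (metis reduce_cong reduce_winv_append(1))

lemma reduce_right_cancel [simp]: "reduce (u @ y) = reduce (v @ y) \<longleftrightarrow> reduce u = reduce v"
  using reduce_cong[of "u @ y" "v @ y" "winv y" "winv y"] reduce_cong[of u v y y] by auto

lemma reduce_snoc:
  assumes "reduced p"
  shows "reduce (p @ [c]) = p @ [c] \<or> p \<noteq> [] \<and> reduce (p @ [c]) = butlast p"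
proof (cases "reduced (p @ [c])")
  case True
  then show ?thesis by (simp add: reduce_reduced)
next
  case False
  then have "p \<noteq> []" by (auto simp: reduced_def)
  then obtain q d where p: "p = q @ [d]" by (metis rev_exhaust)
  then have "c = linv d" "reduced q"
    using False assms by (auto simp: reduced_def successively_append_iff)
  then show ?thesis
    using reduce_append_winv(1)[of q "[d]"] p by (simp add: winv_def reduce_reduced)
qed

text \<open>Multiplying on the right by \<open>b\<close> cancels at most \<open>length b\<close> letters, so it leaves a prefix of
  that much smaller length untouched.\<close>

lemma take_reduce_append:
  assumes "reduced p" "n + length b \<le> length p"
  shows "take n (reduce (p @ b)) = take n p"
proof -
  have "take n (reduce (p @ b)) = take n p \<and> length p \<le> length (reduce (p @ b)) + length b"
    using assms(2)
  proof (induction b rule: rev_induct)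
    case Nil
    then show ?case using assms(1) by (simp add: reduce_reduced)
  next
    case (snoc c b)
    let ?q = "reduce (p @ b)"
    have q: "take n ?q = take n p" "length p \<le> length ?q + length b" using snoc by auto
    have "reduce (p @ b @ [c]) = reduce (?q @ [c])"
      by (metis append.assoc reduce_append(1))
    then show ?case using reduce_snoc[of ?q c] q snoc.prems
      by (auto simp: butlast_conv_take min_def)
  qed
  then show ?thesis by blast
qed

abbreviation wpow :: "'c list \<Rightarrow> nat \<Rightarrow> 'c list" where
  "wpow u k \<equiv> concat (replicate k u)"

lemma wpow_commute: "wpow u k @ u = u @ wpow u k"
  by (induction k) auto

lemma wpow_add: "wpow u (j + k) = wpow u j @ wpow u k"
  by (simp add: replicate_add)

lemma prefix_wpow:
  "prefix q (wpow u k) \<Longrightarrow> \<exists>j q'. j \<le> k \<and> prefix q' u \<and> q = wpow u j @ q'"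
proof (induction k arbitrary: q)
  case (Suc k)
  then consider "prefix q u" | r where "q = u @ r" "prefix r (wpow u k)"
    by (auto simp: prefix_append)
  then show ?case
  proof cases
    case 1
    then show ?thesis by (intro exI[of _ 0]) auto
  next
    case 2
    then obtain j q' where "j \<le> k" "prefix q' u" "r = wpow u j @ q'" using Suc.IH by blast
    then show ?thesis using 2 by (intro exI[of _ "Suc j"] exI[of _ q']) auto
  qed
qed auto

lemma reduce_wpow_cong: "reduce u = reduce v \<Longrightarrow> reduce (wpow u n) = reduce (wpow v n)"
  by (induction n) (auto intro: reduce_cong)

text \<open>For a cyclically reduced word nothing cancels between consecutive copies.\<close>

lemma reduced_wpow:
  assumes "reduced u" "u \<noteq> []" "hd u \<noteq> linv (last u)"
  shows "reduced (wpow u n)"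
proof (induction n)
  case (Suc n)
  have "hd (wpow u n) = hd u" if "n \<noteq> 0"
    using that assms(2) by (cases n) auto
  then show ?case
    using Suc assms by (cases "n = 0") (auto simp: reduced_def successively_append_iff)
qed simp

lemma reduce_wpow_conj: "reduce (wpow (a @ m @ winv a) n) = reduce (a @ wpow m n @ winv a)"
proof (induction n)
  case (Suc n)
  have "reduce (wpow (a @ m @ winv a) (Suc n)) = reduce ((a @ m @ winv a) @ a @ wpow m n @ winv a)"
    using reduce_left_cancel[of "a @ m @ winv a", THEN iffD2, OF Suc] by simp
  also have "\<dots> = reduce (a @ m @ wpow m n @ winv a)"
    using reduce_left_cancel[of "a @ m" "winv a @ a @ wpow m n @ winv a" "wpow m n @ winv a"] by simp
  finally show ?case by simp
qed (simp add: reduce_winv)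

text \<open>Conjugating away a first letter that is inverse to the last one shortens a word without
  changing whether its powers are trivial; the cyclically reduced word reached in the end has no
  trivial powers unless it is empty.\<close>

lemma torsion_free:
  assumes "reduce (wpow u n) = []" "n > 0"
  shows "reduce u = []"
proof -
  have "v = []" if "reduced v" "reduce (wpow v n) = []" for v :: "'a word"
    using that
  proof (induction "length v" arbitrary: v rule: less_induct)
    case less
    show ?case
    proof (rule ccontr)
      assume v: "v \<noteq> []"
      show False
      proof (cases "hd v = linv (last v)")
        case False
        then have "wpow v n = []"
          using reduced_wpow[OF less.prems(1) v] less.prems(2) reduce_reduced by metis
        then show False using v assms(2) by simp
      next
        case True
        obtain a r where ar: "v = a # r" using v by (cases v) auto
        with True have "r \<noteq> []" by (auto simp: linv_neq)
        then obtain m b where r: "r = m @ [b]" by (metis rev_exhaust)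
        then have b: "b = linv a" using True ar by simp
        then have veq: "v = [a] @ m @ winv [a]" using ar r by (simp add: winv_def)
        have m: "reduced m" using less.prems(1) unfolding veq
          by (auto simp: reduced_def successively_Cons successively_append_iff)
        have "reduce ([a] @ wpow m n @ winv [a]) = reduce ([a] @ winv [a])"
          using less.prems(2) reduce_wpow_conj[of n "[a]" m] veq reduce_winv(1)[of "[a]"] by simp
        then have "reduce (wpow m n) = []"
          by (metis append_Nil reduce_Nil reduce_left_cancel reduce_right_cancel)
        then have "m = []" using less.hyps[of m] m ar r by simp
        then show False using less.prems(1) ar r b by (simp add: reduced_def)
      qed
    qed
  qed
  moreover have "reduce (wpow (reduce u) n) = []"
    using assms(1) reduce_wpow_cong[of "reduce u" u n] reduce_reduced[OF reduced_reduce] by metis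
  ultimately show ?thesis using reduced_reduce by metis
qed

lemma inj_reduce_wpow:
  assumes "reduce u \<noteq> []"
  shows "inj (\<lambda>k. reduce (x @ wpow u k))"
proof (rule injI)
  fix i j
  assume "reduce (x @ wpow u i) = reduce (x @ wpow u j)"
  then have e: "reduce (wpow u i) = reduce (wpow u j)" by simp
  have "\<not> (i < j)" if "reduce (wpow u i) = reduce (wpow u j)" for i j
  proof
    assume "i < j"
    then have "reduce (wpow u i @ wpow u (j - i)) = reduce (wpow u i @ [])"
      using that wpow_add[of i "j - i" u] by simp
    then have "reduce (wpow u (j - i)) = []"
      by (simp only: reduce_left_cancel reduce_Nil)
    then show False using torsion_free[of "j - i" u] assms \<open>i < j\<close> by simp
  qed
  from this[OF e] this[OF e[symmetric]] show "i = j" by simp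
qed

section \<open>Munn trees solve the word problem of the free inverse monoid\<close>

text \<open>The Munn tree of a word, given by its vertices in the Cayley graph of the free group.\<close>

definition munn :: "'a word \<Rightarrow> 'a word set" where
  "munn w = reduce ` {p. prefix p w}"

lemma finite_munn [simp]: "finite (munn w)"
  by (simp add: munn_def flip: set_prefixes_eq)

lemma munn_Nil [simp]: "munn [] = {[]}"
  by (auto simp: munn_def)

lemma Nil_in_munn [simp]: "[] \<in> munn w"
  unfolding munn_def by (rule image_eqI[of _ _ "[]"]) auto

lemma reduce_in_munn [simp]: "reduce w \<in> munn w"
  by (force simp: munn_def)

lemma munn_append: "munn (u @ v) = munn u \<union> (\<lambda>g. reduce (u @ g)) ` munn v"
proof -
  have "{p. prefix p (u @ v)} = {p. prefix p u} \<union> (@) u ` {p. prefix p v}"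
    by (auto simp: prefix_append)
  then show ?thesis
    by (simp add: munn_def image_Un image_image reduce_append)
qed

lemma munn_snoc: "munn (w @ [x]) = insert (reduce (w @ [x])) (munn w)"
  by (auto simp: munn_def)

text \<open>Reading \<open>winv u\<close> from the end point of \<open>u\<close> retraces the path of \<open>u\<close> backwards.\<close>

lemma translate_munn_winv: "(\<lambda>g. reduce (u @ g)) ` munn (winv u) = munn u"
proof -
  have "reduce (u @ q) \<in> munn u" if "prefix q (winv u)" for q
  proof -
    obtain r where "winv u = q @ r" using \<open>prefix q (winv u)\<close> unfolding prefix_def by metis
    then have u: "u = winv r @ winv q" by (metis winv_simps(2,3))
    have "reduce (u @ q) = reduce (winv r)"
      unfolding u append.assoc by (rule reduce_append_winv(2))
    moreover have "prefix (winv r) u" unfolding u by simp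
    ultimately show ?thesis by (auto simp: munn_def)
  qed
  then have "(\<lambda>g. reduce (u @ g)) ` munn (winv u) \<subseteq> munn u"
    by (auto simp: munn_def[of "winv u"] reduce_append)
  moreover have "reduce p \<in> (\<lambda>g. reduce (u @ g)) ` munn (winv u)" if "prefix p u" for p
  proof -
    obtain r where u: "u = p @ r" using \<open>prefix p u\<close> unfolding prefix_def by metis
    have "reduce (u @ reduce (winv r)) = reduce (u @ winv r)" by (rule reduce_append(2))
    also have "\<dots> = reduce p" unfolding u append.assoc by (rule reduce_append_winv(1))
    finally have "reduce (u @ reduce (winv r)) = reduce p" .
    moreover have "reduce (winv r) \<in> munn (winv u)" unfolding u munn_def by auto
    ultimately show ?thesis by (metis image_eqI)
  qed
  then have "munn u \<subseteq> (\<lambda>g. reduce (u @ g)) ` munn (winv u)"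
    by (auto simp: munn_def[of u])
  ultimately show ?thesis by blast
qed

lemma munn_idem: "munn (u @ winv u) = munn u"
  by (simp add: munn_append translate_munn_winv)

text \<open>A word of trivial value returns to the origin, so what follows it is not translated.\<close>

lemma munn_append_trivial: "reduce u = [] \<Longrightarrow> munn (u @ v) = munn u \<union> munn v"
proof -
  assume "reduce u = []"
  then have "reduce (u @ reduce p) = reduce p" for p
    using reduce_cong[of u "[]" "reduce p" p] by (simp add: reduce_reduced)
  then have "(\<lambda>g. reduce (u @ g)) ` munn v = munn v"
    unfolding munn_def image_image by (rule image_cong[OF HOL.refl])
  then show ?thesis by (simp add: munn_append)
qed

lemma fim_eq_imp_munn_eq: "fim_eq A u v \<Longrightarrow> munn u = munn v"
proof (induction rule: fim_eq.induct)
  case (inverse u)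
  then show ?case
    using munn_append_trivial[of "u @ winv u" u] munn_idem[of u] by (simp add: reduce_winv)
next
  case (commute u v)
  then show ?case
    using munn_append_trivial[of "u @ winv u" "v @ winv v"]
      munn_append_trivial[of "v @ winv v" "u @ winv u"] by (auto simp: reduce_winv)
next
  case (append u v u' v')
  then have "(\<lambda>g. reduce (u @ g)) = (\<lambda>g. reduce (v @ g))"
    using fim_eq_imp_reduce_eq by fastforce
  then show ?case using append.IH by (simp only: munn_append)
qed simp_all

text \<open>A product of idempotents, one for the path from the origin to each listed vertex.\<close>

definition idem_word :: "'a word list \<Rightarrow> 'a word" where
  "idem_word ts = concat (map (\<lambda>t. t @ winv t) ts)"

lemma idem_word_simps [simp]:
  "idem_word [] = []" "idem_word (t # ts) = t @ winv t @ idem_word ts"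
  "idem_word (ts @ ss) = idem_word ts @ idem_word ss"
  by (simp_all add: idem_word_def)

lemma idem_word_in_lists:
  "set ts \<subseteq> lists (letters A) \<Longrightarrow> idem_word ts \<in> lists (letters A)"
  by (induction ts) auto

lemma fim_eq_append_left: "x \<in> lists (letters A) \<Longrightarrow> fim_eq A u v \<Longrightarrow> fim_eq A (x @ u) (x @ v)"
  by (simp add: fim_eq.append fim_eq.refl)

lemma fim_eq_append_right: "x \<in> lists (letters A) \<Longrightarrow> fim_eq A u v \<Longrightarrow> fim_eq A (u @ x) (v @ x)"
  by (simp add: fim_eq.append fim_eq.refl)

lemma idem_word_commute:
  assumes "t \<in> lists (letters A)" "set ts \<subseteq> lists (letters A)"
  shows "fim_eq A (t @ winv t @ idem_word ts) (idem_word ts @ t @ winv t)"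
  using assms(2)
proof (induction ts)
  case Nil
  have "t @ winv t \<in> lists (letters A)" using assms(1) by simp
  then show ?case by (simp add: fim_eq.refl)
next
  case (Cons s ts)
  have i: "idem_word ts \<in> lists (letters A)" and s: "s \<in> lists (letters A)"
    using Cons.prems idem_word_in_lists[of ts A] by simp_all
  have "fim_eq A ((t @ winv t @ s @ winv s) @ idem_word ts) ((s @ winv s @ t @ winv t) @ idem_word ts)"
    by (rule fim_eq_append_right[OF i fim_eq.commute[OF assms(1) s]])
  moreover have "fim_eq A ((s @ winv s) @ t @ winv t @ idem_word ts) ((s @ winv s) @ idem_word ts @ t @ winv t)"
    using s Cons by (intro fim_eq_append_left) auto
  ultimately show ?case using fim_eq.trans by fastforce
qed

lemma idem_word_absorb:
  assumes "t \<in> set ts" "set ts \<subseteq> lists (letters A)"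
  shows "fim_eq A (t @ winv t @ idem_word ts) (idem_word ts)"
  using assms
proof (induction ts)
  case (Cons s ts)
  have s: "s \<in> lists (letters A)" using Cons.prems(2) by simp
  have t: "t \<in> lists (letters A)" using Cons.prems by blast
  have i: "idem_word ts \<in> lists (letters A)" using Cons.prems(2) idem_word_in_lists[of ts A] by simp
  show ?case
  proof (cases "t = s")
    case True
    have "fim_eq A ((s @ winv s @ s) @ (winv s @ idem_word ts)) (s @ (winv s @ idem_word ts))"
      using i s by (intro fim_eq_append_right fim_eq.inverse) auto
    then show ?thesis using True by simp
  next
    case False
    have "fim_eq A ((t @ winv t @ s @ winv s) @ idem_word ts) ((s @ winv s @ t @ winv t) @ idem_word ts)"
      by (rule fim_eq_append_right[OF i fim_eq.commute[OF t s]])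
    moreover have "fim_eq A ((s @ winv s) @ t @ winv t @ idem_word ts) ((s @ winv s) @ idem_word ts)"
      using s Cons False by (intro fim_eq_append_left) auto
    ultimately show ?thesis using fim_eq.trans by fastforce
  qed
qed simp

lemma idem_word_absorb_list:
  assumes "set ss \<subseteq> set ts" "set ts \<subseteq> lists (letters A)"
  shows "fim_eq A (idem_word ss @ idem_word ts) (idem_word ts)"
  using assms(1)
proof (induction ss)
  case Nil
  show ?case using fim_eq.refl[OF idem_word_in_lists[OF assms(2)]] by simp
next
  case (Cons s ss)
  have "fim_eq A ((s @ winv s) @ idem_word ss @ idem_word ts) ((s @ winv s) @ idem_word ts)"
    using Cons assms(2) by (intro fim_eq_append_left) auto
  moreover have "fim_eq A (s @ winv s @ idem_word ts) (idem_word ts)"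
    using Cons.prems assms(2) by (intro idem_word_absorb) auto
  ultimately show ?case using fim_eq.trans by fastforce
qed

lemma idem_word_commute_list:
  assumes "set ss \<subseteq> lists (letters A)" "set ts \<subseteq> lists (letters A)"
  shows "fim_eq A (idem_word ss @ idem_word ts) (idem_word ts @ idem_word ss)"
  using assms(1)
proof (induction ss)
  case Nil
  show ?case using fim_eq.refl[OF idem_word_in_lists[OF assms(2)]] by simp
next
  case (Cons s ss)
  then have s: "s \<in> lists (letters A)" and i: "idem_word ss \<in> lists (letters A)"
    using idem_word_in_lists[of ss A] by simp_all
  have "fim_eq A ((s @ winv s) @ idem_word ss @ idem_word ts) ((s @ winv s) @ idem_word ts @ idem_word ss)"
    using Cons s by (intro fim_eq_append_left) auto
  moreover have "fim_eq A ((s @ winv s @ idem_word ts) @ idem_word ss) ((idem_word ts @ s @ winv s) @ idem_word ss)"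
    using idem_word_commute[OF s assms(2)] i by (intro fim_eq_append_right) auto
  ultimately show ?case using fim_eq.trans by fastforce
qed

text \<open>Order and repetition of the factors do not matter, because idempotents commute: both
  products equal the product of all the factors of the two lists.\<close>

lemma idem_word_cong:
  assumes "set ss = set ts" "set ts \<subseteq> lists (letters A)"
  shows "fim_eq A (idem_word ss) (idem_word ts)"
proof -
  have "fim_eq A (idem_word ts) (idem_word ss @ idem_word ts)"
       "fim_eq A (idem_word ts @ idem_word ss) (idem_word ss)"
    using idem_word_absorb_list[of ss ts A] idem_word_absorb_list[of ts ss A] assms fim_eq.sym by auto
  then show ?thesis
    using idem_word_commute_list[of ss A ts] assms fim_eq.sym fim_eq.trans by metis
qed

lemma munn_in_lists: "w \<in> lists (letters A) \<Longrightarrow> munn w \<subseteq> lists (letters A)"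
  unfolding munn_def prefix_def using reduce_in_lists by fastforce

text \<open>One more letter moves the path from \<open>g\<close> to \<open>h\<close>. If the letter prolongs \<open>g\<close>, the claim is \<open>h
  = h winv h h\<close>. If it backtracks, then \<open>g = h y\<close> and the left-hand side is \<open>h y winv y\<close>; the
  idempotent \<open>y winv y\<close> commutes with the idempotent \<open>winv h h\<close>, which turns this into \<open>g winv g
  h\<close>.\<close>

lemma fim_eq_absorb_step:
  assumes g: "g \<in> lists (letters A)" "reduced g" and x: "[x] \<in> lists (letters A)"
    and h: "h = reduce (g @ [x])"
  shows "fim_eq A (g @ winv g @ g @ [x]) (g @ winv g @ h @ winv h @ h)"
proof -
  have hl: "h \<in> lists (letters A)"
    unfolding h using g x by (intro reduce_in_lists) auto
  have unfold_h: "fim_eq A (g @ winv g @ h) (g @ winv g @ h @ winv h @ h)"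
    using fim_eq_append_left[OF _ fim_eq.sym[OF fim_eq.inverse[OF hl]], of "g @ winv g"] g(1)
    by simp
  show ?thesis
    using reduce_snoc[OF g(2), of x]
  proof
    assume "reduce (g @ [x]) = g @ [x]"
    then show ?thesis using unfold_h by (simp only: h append.assoc)
  next
    assume "g \<noteq> [] \<and> reduce (g @ [x]) = butlast g"
    then obtain y where y: "g = h @ [y]" unfolding h by (metis append_butlast_last_id)
    have "reduce (g @ [x]) = reduce h"
      unfolding h by (rule reduce_reduced[OF reduced_reduce, symmetric])
    then have "reduce (h @ [y] @ [x]) = reduce (h @ [y] @ winv [y])"
      unfolding y using reduce_append_winv(1)[of h "[y]"] by simp
    then have "reduce [x] = reduce (winv [y])" by (simp only: reduce_left_cancel)
    then have xy: "[x] = winv [y]" by (simp add: winv_def reduce_def)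
    have yl: "[y] \<in> lists (letters A)" using g(1) y by simp
    have 1: "fim_eq A (g @ winv g @ g @ [x]) (g @ [x])"
      using fim_eq_append_right[OF x fim_eq.inverse[OF g(1)]] by simp
    have "fim_eq A (h @ [y] @ winv [y]) (h @ winv h @ h @ [y] @ winv [y])"
      using fim_eq_append_right[OF _ fim_eq.sym[OF fim_eq.inverse[OF hl]], of "[y] @ winv [y]"] yl
      by simp
    moreover have "fim_eq A (h @ winv h @ h @ [y] @ winv [y]) (h @ [y] @ winv [y] @ winv h @ h)"
      using fim_eq_append_left[OF hl fim_eq.commute[OF _ yl, of "winv h"]] hl by simp
    ultimately have "fim_eq A (h @ [y] @ winv [y]) (h @ [y] @ winv [y] @ winv h @ h)"
      by (rule fim_eq.trans)
    then have 2: "fim_eq A (g @ [x]) (g @ winv g @ h)"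
      by (simp add: y xy)
    show ?thesis by (rule fim_eq.trans[OF 1 fim_eq.trans[OF 2 unfold_h]])
  qed
qed

text \<open>Munn's normal form. One more letter adds at most one vertex to the tree, and
  \<open>fim_eq_absorb_step\<close> inserts the idempotent of that vertex.\<close>

lemma fim_eq_normal_form:
  assumes "w \<in> lists (letters A)"
  shows "\<exists>ts. set ts = munn w \<and> fim_eq A w (idem_word ts @ reduce w)"
  using assms
proof (induction w rule: rev_induct)
  case Nil
  then show ?case using fim_eq.refl[of "[]" A] by (intro exI[of _ "[[]]"]) auto
next
  case (snoc x w)
  define g h where "g = reduce w" and "h = reduce (w @ [x])"
  have w: "w \<in> lists (letters A)" and x: "[x] \<in> lists (letters A)" using snoc.prems by auto
  have g: "g \<in> lists (letters A)" "reduced g"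
    using w reduce_in_lists by (auto simp only: g_def reduced_reduce)
  have h: "h = reduce (g @ [x])" by (simp add: g_def h_def reduce_append)
  obtain ts where ts: "set ts = munn w" "fim_eq A w (idem_word ts @ g)"
    using snoc.IH w unfolding g_def by blast
  have il: "idem_word ts \<in> lists (letters A)"
    using ts(1) munn_in_lists[OF w] by (intro idem_word_in_lists) simp
  have 1: "fim_eq A (w @ [x]) (idem_word ts @ g @ [x])"
    using fim_eq_append_right[OF x ts(2)] by simp
  have 2: "fim_eq A (idem_word ts @ g @ [x]) (idem_word ts @ g @ winv g @ g @ [x])"
    using fim_eq_append_left[OF il fim_eq_append_right[OF x fim_eq.sym[OF fim_eq.inverse[OF g(1)]]]]
    by simp
  have 3: "fim_eq A (idem_word ts @ g @ winv g @ g @ [x])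
     (idem_word ts @ g @ winv g @ h @ winv h @ h)"
    by (rule fim_eq_append_left[OF il fim_eq_absorb_step[OF g x h]])
  have "set (ts @ [g, h]) = munn (w @ [x])"
    using ts(1) by (auto simp: munn_snoc g_def h_def)
  moreover have "fim_eq A (w @ [x]) (idem_word (ts @ [g, h]) @ h)"
    using fim_eq.trans[OF 1 fim_eq.trans[OF 2 3]] by simp
  ultimately show ?case unfolding h_def by blast
qed

text \<open>Munn's solution of the word problem.\<close>

lemma fim_eq_iff_munn:
  assumes u: "u \<in> lists (letters A)" and v: "v \<in> lists (letters A)"
  shows "fim_eq A u v \<longleftrightarrow> munn u = munn v \<and> reduce u = reduce v"
proof
  assume eq: "munn u = munn v \<and> reduce u = reduce v"
  obtain ss ts where s: "set ss = munn u" "fim_eq A u (idem_word ss @ reduce u)"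
    and t: "set ts = munn v" "fim_eq A v (idem_word ts @ reduce v)"
    using fim_eq_normal_form u v by metis
  have "fim_eq A (idem_word ss @ reduce u) (idem_word ts @ reduce u)"
    using idem_word_cong[of ss ts A] s t eq munn_in_lists[OF v] reduce_in_lists[OF u]
    by (intro fim_eq_append_right) auto
  then show "fim_eq A u v" using s(2) t(2) eq fim_eq.sym fim_eq.trans by metis
qed (metis fim_eq_imp_munn_eq fim_eq_imp_reduce_eq)

section \<open>Trees of elements of the free inverse monoid\<close>

text \<open>All words of a class have the same Munn tree, so this union is the Munn tree of any
  representative, see \<open>tree_class\<close>.\<close>

definition tree :: "'a word set \<Rightarrow> 'a word set" where
  "tree X = (\<Union>w\<in>X. munn w)"

lemma tree_class: "u \<in> lists (letters A) \<Longrightarrow> tree (fim_class A u) = munn u"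
  unfolding tree_def fim_class_def fim_rel_def
  using fim_eq_imp_munn_eq fim_eq.refl by fastforce

lemma FIM_rep:
  assumes "X \<in> carrier (FIM A)"
  obtains w where "w \<in> lists (letters A)" "X = fim_class A w"
    "tree X = munn w" "fim_to_fg X = reduce w"
  using assms tree_class fim_to_fg_class unfolding carrier_FIM by blast

lemma class_in_FIM [simp]: "w \<in> lists (letters A) \<Longrightarrow> fim_class A w \<in> carrier (FIM A)"
  by (auto simp: carrier_FIM)

lemma finite_tree: "X \<in> carrier (FIM A) \<Longrightarrow> finite (tree X)"
  by (erule FIM_rep) simp

lemma Nil_in_tree: "X \<in> carrier (FIM A) \<Longrightarrow> [] \<in> tree X"
  by (erule FIM_rep) simp

lemma fg_in_tree: "X \<in> carrier (FIM A) \<Longrightarrow> fim_to_fg X \<in> tree X"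
  by (erule FIM_rep) simp

lemma tree_one: "tree \<one>\<^bsub>FIM A\<^esub> = {[]}" "fim_to_fg \<one>\<^bsub>FIM A\<^esub> = []"
  using tree_class[of "[]" A] fim_to_fg_class[of "[]" A] by (simp_all add: one_FIM)

lemma fg_mult:
  "X \<in> carrier (FIM A) \<Longrightarrow> Y \<in> carrier (FIM A) \<Longrightarrow>
     fim_to_fg (X \<otimes>\<^bsub>FIM A\<^esub> Y) = reduce (fim_to_fg X @ fim_to_fg Y)"
  using hom_mult[OF fim_to_fg_hom] by (simp add: FG_def)

lemma tree_mult:
  assumes "X \<in> carrier (FIM A)" "Y \<in> carrier (FIM A)"
  shows "tree (X \<otimes>\<^bsub>FIM A\<^esub> Y) = tree X \<union> (\<lambda>g. reduce (fim_to_fg X @ g)) ` tree Y"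
proof -
  obtain u where u: "u \<in> lists (letters A)" "X = fim_class A u" "tree X = munn u" "fim_to_fg X = reduce u"
    using FIM_rep[OF assms(1)] .
  obtain v where v: "v \<in> lists (letters A)" "Y = fim_class A v" "tree Y = munn v"
    using FIM_rep[OF assms(2)] by metis
  have "tree (X \<otimes>\<^bsub>FIM A\<^esub> Y) = munn (u @ v)"
    using u(1) v(1) unfolding u(2) v(2) by (simp add: mult_FIM tree_class)
  then show ?thesis using u v by (simp add: munn_append reduce_append)
qed

lemma tree_mult_trivial:
  assumes "X \<in> carrier (FIM A)" "Y \<in> carrier (FIM A)" "fim_to_fg X = []"
  shows "tree (X \<otimes>\<^bsub>FIM A\<^esub> Y) = tree X \<union> tree Y"
proof -
  obtain v where v: "tree Y = munn v" using FIM_rep[OF assms(2)] by metis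
  have "reduce g = g" if "g \<in> munn v" for g
    using that by (auto simp: munn_def reduce_reduced)
  then show ?thesis using assms v by (simp add: tree_mult)
qed

lemma FIM_eqI:
  assumes "X \<in> carrier (FIM A)" "Y \<in> carrier (FIM A)" "tree X = tree Y" "fim_to_fg X = fim_to_fg Y"
  shows "X = Y"
proof -
  obtain u where u: "u \<in> lists (letters A)" "X = fim_class A u" "tree X = munn u" "fim_to_fg X = reduce u"
    using FIM_rep[OF assms(1)] .
  obtain v where v: "v \<in> lists (letters A)" "Y = fim_class A v" "tree Y = munn v" "fim_to_fg Y = reduce v"
    using FIM_rep[OF assms(2)] .
  have "fim_eq A u v" using u v assms fim_eq_iff_munn[of u A v] by simp
  then show ?thesis unfolding u(2) v(2) using u(1) v(1) by (simp add: fim_class_eq_iff)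
qed

text \<open>The group image is a vertex of the tree, so only finitely many elements share a tree.\<close>

lemma finite_FIM_bounded_tree:
  assumes "finite R"
  shows "finite {X \<in> carrier (FIM A). tree X \<subseteq> R}"
proof (rule finite_imageD)
  let ?f = "\<lambda>X. (tree X, fim_to_fg X)" and ?S = "{X \<in> carrier (FIM A). tree X \<subseteq> R}"
  have "?f ` ?S \<subseteq> Pow R \<times> R" using fg_in_tree by fastforce
  then show "finite (?f ` ?S)" using assms by (meson finite_Pow_iff finite_SigmaI finite_subset)
  show "inj_on ?f ?S" by (rule inj_onI) (simp add: FIM_eqI)
qed

text \<open>The free inverse monoid is E-unitary: for trivial group image the tree of \<open>X X\<close> is that of
  \<open>X\<close>.\<close>

lemma idempotent_iff_fg_trivial:
  assumes X: "X \<in> carrier (FIM A)"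
  shows "X \<in> idempotents (FIM A) \<longleftrightarrow> fim_to_fg X = []"
proof
  interpret M: monoid "FIM A" by (rule monoid_FIM)
  assume g: "fim_to_fg X = []"
  then have "X \<otimes>\<^bsub>FIM A\<^esub> X = X"
    using X tree_mult_trivial[OF X X] fg_mult[OF X X] by - (rule FIM_eqI[of _ A], auto)
  then show "X \<in> idempotents (FIM A)" using X by (simp add: idempotents_def)
next
  assume "X \<in> idempotents (FIM A)"
  then have e: "reduce (fim_to_fg X @ fim_to_fg X) = fim_to_fg X"
    using fg_mult[OF X X] by (simp add: idempotents_def)
  obtain w where w: "fim_to_fg X = reduce w" using FIM_rep[OF X] by metis
  have "reduce (reduce w @ reduce w) = reduce (reduce w @ [])"
    using e w by (simp add: reduce_reduced)
  then have "reduce (reduce w) = reduce []" by (simp only: reduce_left_cancel)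
  then show "fim_to_fg X = []" using w by (simp add: reduce_reduced)
qed

lemma tree_in_FG: "X \<in> carrier (FIM A) \<Longrightarrow> tree X \<subseteq> carrier (FG A)"
proof (erule FIM_rep)
  fix w assume "w \<in> lists (letters A)" "tree X = munn w"
  then show "tree X \<subseteq> carrier (FG A)"
    using munn_in_lists[of w A] by (auto simp: FG_def munn_def)
qed

text \<open>Any \<open>Y\<close> with \<open>X Y X = X\<close> gives the same idempotent \<open>X Y\<close>, namely the one on the tree of \<open>X\<close>.
  This identifies \<open>X X^{-1}\<close> with the image of itself under an endomorphism that fixes \<open>X\<close>,
  without having to know the image of \<open>X^{-1}\<close>.\<close>

lemma idempotent_of_regular:
  assumes X: "X \<in> carrier (FIM A)" and Y: "Y \<in> carrier (FIM A)"
    and e: "X \<otimes>\<^bsub>FIM A\<^esub> Y \<otimes>\<^bsub>FIM A\<^esub> X = X"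
  shows "tree (X \<otimes>\<^bsub>FIM A\<^esub> Y) = tree X" "fim_to_fg (X \<otimes>\<^bsub>FIM A\<^esub> Y) = []"
proof -
  interpret M: monoid "FIM A" by (rule monoid_FIM)
  have XY: "X \<otimes>\<^bsub>FIM A\<^esub> Y \<in> carrier (FIM A)" using X Y by simp
  have "tree (X \<otimes>\<^bsub>FIM A\<^esub> Y) \<subseteq> tree X" using tree_mult[OF XY X] e by auto
  then show "tree (X \<otimes>\<^bsub>FIM A\<^esub> Y) = tree X" using tree_mult[OF X Y] by auto
  have "reduce (fim_to_fg (X \<otimes>\<^bsub>FIM A\<^esub> Y) @ fim_to_fg X) = reduce ([] @ fim_to_fg X)"
    using fg_mult[OF XY X] e by (metis append_Nil reduce_append(2) FIM_rep[OF X] reduce_reduced reduced_reduce)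
  then have "reduce (fim_to_fg (X \<otimes>\<^bsub>FIM A\<^esub> Y)) = []" by (simp only: reduce_right_cancel reduce_Nil)
  then show "fim_to_fg (X \<otimes>\<^bsub>FIM A\<^esub> Y) = []"
    by (metis FIM_rep[OF XY] reduce_reduced reduced_reduce)
qed

section \<open>Periodic points of an endomorphism\<close>

lemma funpow_closed: "(\<And>x. x \<in> S \<Longrightarrow> f x \<in> S) \<Longrightarrow> x \<in> S \<Longrightarrow> (f ^^ n) x \<in> S"
  by (induction n) auto

lemma finite_inj_periodic:
  assumes "finite S" "inj_on f S" "\<And>x. x \<in> S \<Longrightarrow> f x \<in> S" "x \<in> S"
  shows "\<exists>m>0. (f ^^ m) x = x"
proof -
  have cl: "(f ^^ n) y \<in> S" if "y \<in> S" for n y using assms(3) that by (rule funpow_closed)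
  have "\<not> inj_on (\<lambda>n. (f ^^ n) x) UNIV"
    using cl[OF assms(4)] finite_subset[OF _ assms(1), of "range (\<lambda>n. (f ^^ n) x)"]
      finite_imageD infinite_UNIV_nat by blast
  then obtain i j where ij: "i < j" "(f ^^ i) x = (f ^^ j) x"
    unfolding inj_on_def by (metis linorder_neqE_nat)
  have inj: "(f ^^ n) y = (f ^^ n) z \<Longrightarrow> y \<in> S \<Longrightarrow> z \<in> S \<Longrightarrow> y = z" for n y z
    by (induction n) (use cl assms(2) in \<open>auto dest: inj_onD\<close>)
  have "(f ^^ i) ((f ^^ (j - i)) x) = (f ^^ i) x"
    using ij by (metis comp_apply funpow_add le_add_diff_inverse less_imp_le)
  then have "(f ^^ (j - i)) x = x" using inj cl assms(4) by blast
  then show ?thesis using ij(1) by (intro exI[of _ "j - i"]) auto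
qed

lemma perpoints_iff: "x \<in> perpoints S f \<longleftrightarrow> x \<in> S \<and> (\<exists>n>0. (f ^^ n) x = x)"
  by (auto simp: perpoints_def fixpoints_def Suc_le_eq)

locale fim_endomorphism =
  fixes A :: "'a set" and \<phi> :: "'a word set \<Rightarrow> 'a word set"
  assumes hom: "\<phi> \<in> hom (FIM A) (FIM A)" and one: "\<phi> \<one>\<^bsub>FIM A\<^esub> = \<one>\<^bsub>FIM A\<^esub>"
begin

sublocale M: monoid "FIM A" by (rule monoid_FIM)

abbreviation "\<theta> \<equiv> fg_induced A \<phi>"

lemma closed: "X \<in> carrier (FIM A) \<Longrightarrow> \<phi> X \<in> carrier (FIM A)"
  using hom by (rule hom_in_carrier)

lemma pow_closed: "X \<in> carrier (FIM A) \<Longrightarrow> (\<phi> ^^ n) X \<in> carrier (FIM A)"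
  by (rule funpow_closed) (rule closed)

lemma pow_mult:
  "X \<in> carrier (FIM A) \<Longrightarrow> Y \<in> carrier (FIM A) \<Longrightarrow>
     (\<phi> ^^ n) (X \<otimes>\<^bsub>FIM A\<^esub> Y) = (\<phi> ^^ n) X \<otimes>\<^bsub>FIM A\<^esub> (\<phi> ^^ n) Y"
  by (induction n) (auto simp: hom_mult[OF hom] pow_closed)

lemma pow_one: "(\<phi> ^^ n) \<one>\<^bsub>FIM A\<^esub> = \<one>\<^bsub>FIM A\<^esub>"
  by (induction n) (auto simp: one)

lemma fg_endo: "X \<in> carrier (FIM A) \<Longrightarrow> fim_to_fg (\<phi> X) = \<theta> (fim_to_fg X)"
  by (erule FIM_rep) (simp add: fg_induced_reduce[OF hom one])

lemma fg_pow: "X \<in> carrier (FIM A) \<Longrightarrow> fim_to_fg ((\<phi> ^^ n) X) = (\<theta> ^^ n) (fim_to_fg X)"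
  by (induction n) (auto simp: fg_endo pow_closed)

text \<open>A vertex \<open>g\<close> of the tree is the group image of a left factor of \<open>X\<close>, and the image of this
  factor is a left factor of \<open>\<phi> X\<close> with group image \<open>\<theta> g\<close>.\<close>

lemma tree_endo:
  assumes X: "X \<in> carrier (FIM A)" and g: "g \<in> tree X"
  shows "\<theta> g \<in> tree (\<phi> X)"
proof -
  obtain w where w: "w \<in> lists (letters A)" "X = fim_class A w" "tree X = munn w"
    using FIM_rep[OF X] by metis
  then obtain p q where pq: "g = reduce p" "w = p @ q"
    using g by (auto simp: munn_def prefix_def)
  then have l: "p \<in> lists (letters A)" "q \<in> lists (letters A)" using w by auto
  let ?P = "fim_class A p" and ?Q = "fim_class A q"
  have "X = ?P \<otimes>\<^bsub>FIM A\<^esub> ?Q" using w pq l by (simp add: mult_FIM)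
  then have "\<phi> X = \<phi> ?P \<otimes>\<^bsub>FIM A\<^esub> \<phi> ?Q" using hom_mult[OF hom] l by simp
  then have "tree (\<phi> ?P) \<subseteq> tree (\<phi> X)" using tree_mult[of "\<phi> ?P" A "\<phi> ?Q"] l closed by simp
  moreover have "\<theta> g = fim_to_fg (\<phi> ?P)"
    using fg_endo[of ?P] l fim_to_fg_class[OF l(1)] pq by simp
  ultimately show ?thesis using fg_in_tree[of "\<phi> ?P" A] closed l by auto
qed

lemma tree_pow:
  "X \<in> carrier (FIM A) \<Longrightarrow> g \<in> tree X \<Longrightarrow> (\<theta> ^^ n) g \<in> tree ((\<phi> ^^ n) X)"
  by (induction n) (auto simp: tree_endo pow_closed)

lemma induced_closed: "g \<in> carrier (FG A) \<Longrightarrow> \<theta> g \<in> carrier (FG A)"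
proof -
  assume g: "g \<in> carrier (FG A)"
  then have l: "g \<in> lists (letters A)" "reduce g = g" by (auto simp: FG_def reduce_reduced)
  then have "\<theta> g = fim_to_fg (\<phi> (fim_class A g))"
    using fg_induced_reduce[OF hom one l(1)] by simp
  then show ?thesis using hom_in_carrier[OF fim_to_fg_hom closed[of "fim_class A g"]] l by simp
qed

primrec orbit_product :: "'a word set \<Rightarrow> nat \<Rightarrow> 'a word set" where
  "orbit_product U 0 = \<one>\<^bsub>FIM A\<^esub>"
| "orbit_product U (Suc n) = orbit_product U n \<otimes>\<^bsub>FIM A\<^esub> (\<phi> ^^ n) U"

lemma orbit_product_closed: "U \<in> carrier (FIM A) \<Longrightarrow> orbit_product U n \<in> carrier (FIM A)"
  by (induction n) (auto simp: pow_closed)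

lemma fg_idem_pow:
  assumes "U \<in> carrier (FIM A)" "fim_to_fg U = []"
  shows "fim_to_fg ((\<phi> ^^ n) U) = []"
proof -
  have "fim_to_fg ((\<phi> ^^ n) U) = (\<theta> ^^ n) []" using fg_pow assms by simp
  also have "\<dots> = fim_to_fg ((\<phi> ^^ n) \<one>\<^bsub>FIM A\<^esub>)" by (simp add: fg_pow tree_one)
  also have "\<dots> = []" by (simp add: pow_one tree_one)
  finally show ?thesis .
qed

lemma orbit_product_tree:
  assumes U: "U \<in> carrier (FIM A)" "fim_to_fg U = []"
  shows "fim_to_fg (orbit_product U n) = [] \<and>
    tree (orbit_product U n) = insert [] (\<Union>i<n. tree ((\<phi> ^^ i) U))"
proof (induction n)
  case (Suc n)
  have "orbit_product U n \<in> carrier (FIM A)" "(\<phi> ^^ n) U \<in> carrier (FIM A)"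
    using U orbit_product_closed pow_closed by auto
  then show ?case using Suc fg_idem_pow[OF U, of n]
    by (auto simp: fg_mult tree_mult_trivial lessThan_Suc)
qed (simp add: tree_one)

lemma orbit_product_image:
  "U \<in> carrier (FIM A) \<Longrightarrow> \<phi> (orbit_product U n) = orbit_product (\<phi> U) n"
  by (induction n) (auto simp: one hom_mult[OF hom] orbit_product_closed pow_closed funpow_swap1)

text \<open>The endomorphism permutes the factors cyclically, and the tree of a product of idempotents
  is the union of their trees, so it does not depend on the order.\<close>

lemma orbit_product_fixed:
  assumes U: "U \<in> carrier (FIM A)" "fim_to_fg U = []" and n: "(\<phi> ^^ n) U = U"
  shows "orbit_product U n \<in> fixpoints (carrier (FIM A)) \<phi>"
proof -
  have U': "\<phi> U \<in> carrier (FIM A)" "fim_to_fg (\<phi> U) = []"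
    using closed[OF U(1)] fg_idem_pow[OF U, of 1] by auto
  have p: "(\<phi> ^^ i) (\<phi> U) = (\<phi> ^^ Suc i) U" for i by (simp add: funpow_swap1)
  have "(\<Union>i<n. tree ((\<phi> ^^ i) (\<phi> U))) = (\<Union>i<n. tree ((\<phi> ^^ Suc i) U))" by (simp only: p)
  also have "\<dots> = (\<Union>i<n. tree ((\<phi> ^^ i) U))"
  proof (cases n)
    case (Suc k)
    have "(\<Union>i<n. tree ((\<phi> ^^ Suc i) U)) = (\<Union>i<k. tree ((\<phi> ^^ Suc i) U)) \<union> tree U"
      using n Suc by (auto simp: lessThan_Suc)
    also have "\<dots> = (\<Union>i<n. tree ((\<phi> ^^ i) U))"
      unfolding Suc lessThan_Suc_eq_insert_0 by auto
    finally show ?thesis .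
  qed simp
  finally have shift: "(\<Union>i<n. tree ((\<phi> ^^ i) (\<phi> U))) = (\<Union>i<n. tree ((\<phi> ^^ i) U))" .
  have "orbit_product (\<phi> U) n = orbit_product U n"
  proof (rule FIM_eqI[OF orbit_product_closed[OF U'(1)] orbit_product_closed[OF U(1)]])
    show "tree (orbit_product (\<phi> U) n) = tree (orbit_product U n)"
      using orbit_product_tree[OF U, of n] orbit_product_tree[OF U', of n] shift by metis
    show "fim_to_fg (orbit_product (\<phi> U) n) = fim_to_fg (orbit_product U n)"
      using orbit_product_tree[OF U, of n] orbit_product_tree[OF U', of n] by metis
  qed
  then show ?thesis using orbit_product_closed[OF U(1)] orbit_product_image[OF U(1)]
    by (simp add: fixpoints_def)
qed

lemma pow_wpow:
  assumes w: "w \<in> lists (letters A)" and "(\<phi> ^^ n) (fim_class A w) = fim_class A w"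
  shows "(\<phi> ^^ n) (fim_class A (wpow w k)) = fim_class A (wpow w k) \<and> wpow w k \<in> lists (letters A)"
proof (induction k)
  case 0
  then show ?case using pow_one one_FIM by (metis concat.simps(1) lists.Nil replicate_0)
next
  case (Suc k)
  have "fim_class A (wpow w (Suc k)) = fim_class A w \<otimes>\<^bsub>FIM A\<^esub> fim_class A (wpow w k)"
    using Suc w by (simp add: mult_FIM)
  then show ?case using Suc assms pow_mult[of "fim_class A w" "fim_class A (wpow w k)" n] by simp
qed

text \<open>A periodic \<open>X\<close> with nontrivial group image \<open>g\<close> yields, for each \<open>k\<close>, a fixed idempotent
  whose tree contains \<open>g^k\<close>: the product of the orbit of \<open>X^k X^{-k}\<close>.\<close>

lemma finite_fix_imp_per_idempotent:
  assumes fin: "finite (fixpoints (carrier (FIM A)) \<phi>)"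
  shows "perpoints (carrier (FIM A)) \<phi> \<subseteq> idempotents (FIM A)"
proof
  fix X assume "X \<in> perpoints (carrier (FIM A)) \<phi>"
  then obtain n where n: "n > 0" "(\<phi> ^^ n) X = X" and X: "X \<in> carrier (FIM A)"
    using perpoints_iff by metis
  obtain w where w: "w \<in> lists (letters A)" "X = fim_class A w" "fim_to_fg X = reduce w"
    using FIM_rep[OF X] by metis
  have "\<exists>F\<in>fixpoints (carrier (FIM A)) \<phi>. reduce (wpow w k) \<in> tree F" for k
  proof -
    let ?v = "wpow w k"
    have v: "?v \<in> lists (letters A)" "(\<phi> ^^ n) (fim_class A ?v) = fim_class A ?v"
      using pow_wpow[OF w(1), of n k] n(2) w(2) by auto
    define V where "V = fim_class A ?v"
    define V' where "V' = fim_class A (winv ?v)"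
    have V: "V \<in> carrier (FIM A)" "V' \<in> carrier (FIM A)" "(\<phi> ^^ n) V = V"
      using v by (simp_all add: V_def V'_def)
    have reg: "V \<otimes>\<^bsub>FIM A\<^esub> V' \<otimes>\<^bsub>FIM A\<^esub> V = V"
      using v(1) fim_eq.inverse[OF v(1)] by (simp add: V_def V'_def mult_FIM fim_class_eq_iff)
    have V'': "(\<phi> ^^ n) V' \<in> carrier (FIM A)" using V pow_closed by blast
    have reg': "V \<otimes>\<^bsub>FIM A\<^esub> (\<phi> ^^ n) V' \<otimes>\<^bsub>FIM A\<^esub> V = V"
      using pow_mult[of "V \<otimes>\<^bsub>FIM A\<^esub> V'" V n] pow_mult[of V V' n] V reg by simp
    let ?U = "V \<otimes>\<^bsub>FIM A\<^esub> V'"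
    have U: "?U \<in> carrier (FIM A)" "fim_to_fg ?U = []" "tree ?U = tree V"
      using idempotent_of_regular[OF V(1,2) reg] V by auto
    have "(\<phi> ^^ n) ?U = V \<otimes>\<^bsub>FIM A\<^esub> (\<phi> ^^ n) V'" using pow_mult V by simp
    also have "\<dots> = ?U"
      using idempotent_of_regular[OF V(1) V'' reg'] U M.m_closed[OF V(1) V'']
      by - (rule FIM_eqI[of _ A], simp_all)
    finally have "orbit_product ?U n \<in> fixpoints (carrier (FIM A)) \<phi>"
      using orbit_product_fixed U by blast
    moreover have "reduce ?v \<in> tree (orbit_product ?U n)"
      using orbit_product_tree[OF U(1,2), of n] n(1) U(3) tree_class[OF v(1)] unfolding V_def[symmetric]
      by (auto intro!: bexI[of _ 0])
    ultimately show ?thesis by blast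
  qed
  then have "range (\<lambda>k. reduce ([] @ wpow w k)) \<subseteq> (\<Union>F\<in>fixpoints (carrier (FIM A)) \<phi>. tree F)"
    by auto
  moreover have "finite (\<Union>F\<in>fixpoints (carrier (FIM A)) \<phi>. tree F)"
    using fin finite_tree by (auto simp: fixpoints_def)
  ultimately have "finite (range (\<lambda>k. reduce ([] @ wpow w k)))" using finite_subset by blast
  then have "\<not> inj (\<lambda>k. reduce ([] @ wpow w k))" using finite_imageD infinite_UNIV_nat by blast
  then have "reduce w = []" using inj_reduce_wpow by blast
  then show "X \<in> idempotents (FIM A)" using w X idempotent_iff_fg_trivial by metis
qed

end

locale fim_endomorphism_inj = fim_endomorphism +
  assumes inj: "inj_on (fg_induced A \<phi>) (carrier (FG A))"
begin

lemma inj_pow: "inj_on (\<theta> ^^ n) (carrier (FG A))"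
proof (induction n)
  case (Suc n)
  have "(\<theta> ^^ n) g \<in> carrier (FG A)" if "g \<in> carrier (FG A)" for g
    using that by (intro funpow_closed) (auto simp: induced_closed)
  then have "inj_on \<theta> ((\<theta> ^^ n) ` carrier (FG A))" by (intro inj_on_subset[OF inj]) auto
  then show ?case using comp_inj_on[OF Suc] by (simp add: o_def)
qed simp

text \<open>An injective self-map of the finite tree permutes it.\<close>

lemma tree_point_periodic:
  assumes X: "X \<in> carrier (FIM A)" "(\<phi> ^^ n) X = X" and g: "g \<in> tree X"
  shows "\<exists>m>0. (\<theta> ^^ (n * m)) g = g"
proof -
  have "\<exists>m>0. ((\<theta> ^^ n) ^^ m) g = g"
    using finite_tree[OF X(1)] inj_on_subset[OF inj_pow tree_in_FG[OF X(1)]] _ g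
    by (rule finite_inj_periodic) (use tree_pow[OF X(1), of _ n] X(2) in auto)
  then show ?thesis by (simp add: funpow_mult mult.commute)
qed

text \<open>Let \<open>g\<close> be a vertex of the tree of \<open>X\<close>, and \<open>P\<close> the left factor of \<open>X\<close> that leads to \<open>g\<close>.
  The element \<open>X P\<close> has the tree of \<open>X\<close> and group image \<open>g\<close>. A power of \<open>\<phi>\<close> that fixes \<open>X\<close>, and
  whose induced map fixes \<open>g\<close>, sends \<open>P\<close> to an element with group image \<open>g\<close> and tree inside that
  of \<open>X\<close>; hence it fixes \<open>X P\<close>, which can be idempotent only if \<open>g\<close> is trivial.\<close>

lemma per_idempotent_imp_trivial:
  assumes per: "perpoints (carrier (FIM A)) \<phi> \<subseteq> idempotents (FIM A)"
  shows "perpoints (carrier (FIM A)) \<phi> \<subseteq> {\<one>\<^bsub>FIM A\<^esub>}"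
proof
  fix X assume XP: "X \<in> perpoints (carrier (FIM A)) \<phi>"
  then obtain n where n: "n > 0" "(\<phi> ^^ n) X = X" and X: "X \<in> carrier (FIM A)"
    using perpoints_iff by metis
  have fgX: "fim_to_fg X = []" using XP per X idempotent_iff_fg_trivial by blast
  obtain w where w: "w \<in> lists (letters A)" "X = fim_class A w" "tree X = munn w"
    using FIM_rep[OF X] by metis
  have "g = []" if g: "g \<in> tree X" for g
  proof -
    obtain m where m: "m > 0" "(\<theta> ^^ (n * m)) g = g"
      using tree_point_periodic[OF X n(2) g] by blast
    let ?N = "n * m"
    obtain p q where pq: "g = reduce p" "w = p @ q"
      using g w by (auto simp: munn_def prefix_def)
    then have l: "p \<in> lists (letters A)" "q \<in> lists (letters A)" using w by auto
    let ?P = "fim_class A p" and ?Q = "fim_class A q"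
    have PQ: "?P \<in> carrier (FIM A)" "?Q \<in> carrier (FIM A)" using l by simp_all
    have XPQ: "X = ?P \<otimes>\<^bsub>FIM A\<^esub> ?Q" using w pq l by (simp add: mult_FIM)
    have fgP: "fim_to_fg ?P = g" using fim_to_fg_class[OF l(1)] pq by simp
    let ?Y = "X \<otimes>\<^bsub>FIM A\<^esub> ?P"
    have XN: "(\<phi> ^^ ?N) X = X"
      using n(2) by (induction m) (auto simp: funpow_add)
    have "tree ?P \<subseteq> tree X" using tree_mult[OF PQ] XPQ by auto
    moreover have "tree ((\<phi> ^^ ?N) ?P) \<subseteq> tree X"
      using tree_mult[OF PQ[THEN pow_closed, of ?N]] pow_mult[OF PQ, of ?N] XN XPQ by auto
    moreover have "fim_to_fg ((\<phi> ^^ ?N) ?P) = g" using fg_pow PQ(1) fgP m(2) by simp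
    ultimately have "(\<phi> ^^ ?N) ?Y = ?Y"
      unfolding pow_mult[OF X PQ(1)] XN using X PQ fgX fgP pow_closed[OF PQ(1), of ?N]
      by - (rule FIM_eqI[of _ A], auto simp: tree_mult_trivial fg_mult)
    then have "?Y \<in> perpoints (carrier (FIM A)) \<phi>"
      using X PQ n(1) m(1) perpoints_iff M.m_closed by (metis nat_0_less_mult_iff)
    then have "?Y \<in> idempotents (FIM A)" using per by blast
    then have "fim_to_fg ?Y = []" using idempotent_iff_fg_trivial[OF M.m_closed[OF X PQ(1)]] by simp
    then have "reduce g = []" using fg_mult[OF X PQ(1)] fgX fgP by simp
    then show "g = []" unfolding pq(1) by (simp add: reduce_reduced)
  qed
  then have "tree X = {[]}" using Nil_in_tree[OF X] by auto
  then have "X = \<one>\<^bsub>FIM A\<^esub>"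
    using X fgX tree_one[of A] by - (rule FIM_eqI[of _ A], simp_all)
  then show "X \<in> {\<one>\<^bsub>FIM A\<^esub>}" by simp
qed

end

section \<open>Convergence to an end of the free group\<close>

lemma length_reduce_le: "length (reduce w) \<le> length w"
proof (induction w)
  case (Cons x w)
  have "length (cons_reduce x v) \<le> Suc (length v)" for v by (cases v) auto
  from this[of "reduce w"] Cons show ?case by (simp add: reduce_def)
qed simp

text \<open>Over a finite alphabet there are only finitely many words of each length.\<close>

lemma inj_lengths_unbounded:
  fixes q :: "nat \<Rightarrow> 'a word"
  assumes "finite A" "inj q" "\<And>k. q k \<in> lists (letters A)"
  shows "\<exists>K. \<forall>k\<ge>K. n \<le> length (q k)"
proof -
  have "finite (letters A)" using assms(1) by (simp add: letters_def)
  then have "finite {w. set w \<subseteq> letters A \<and> length w \<le> n}" by (rule finite_lists_length_le)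
  then have "finite (q -` {w. set w \<subseteq> letters A \<and> length w \<le> n})"
    using assms(2) by (rule finite_vimageI)
  moreover have "{k. length (q k) < n} \<subseteq> q -` {w. set w \<subseteq> letters A \<and> length w \<le> n}"
    using assms(3) by (auto simp: in_lists_conv_set)
  ultimately have "finite {k. length (q k) < n}" using finite_subset by blast
  then obtain K where "\<forall>k\<in>{k. length (q k) < n}. k < K" using finite_nat_set_iff_bounded by metis
  then show ?thesis by (intro exI[of _ K]) (auto simp: not_less[symmetric])
qed

text \<open>Convergence in the prefix metric to the infinite word \<open>f\<close>, see \<open>limitin_end\<close>.\<close>

definition tends_to_end :: "(nat \<Rightarrow> 'a word) \<Rightarrow> (nat \<Rightarrow> 'a letter) \<Rightarrow> bool" where
  "tends_to_end q f \<longleftrightarrow> (\<forall>m. \<exists>K. \<forall>k\<ge>K. m \<le> length (q k) \<and> take m (q k) = map f [0..<m])"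

text \<open>Consecutive terms are at bounded distance while their lengths tend to infinity, so their
  common prefixes get arbitrarily long. The prefix metric is an ultrametric, so this makes the
  sequence Cauchy.\<close>

lemma bounded_steps_converge:
  assumes A: "finite A" and p: "\<And>k. p k \<in> carrier (FG A)" and inj: "inj p"
    and step: "\<And>k. p (Suc k) = reduce (p k @ c k)" "\<And>k. length (c k) \<le> C"
  shows "\<exists>f. InfWord f \<in> FG_hat A \<and> tends_to_end p f"
proof -
  have pl: "p k \<in> lists (letters A)" "reduced (p k)" for k using p[of k] by (auto simp: FG_def)
  have "\<exists>K. \<forall>k\<ge>K. m + C \<le> length (p k)" for m
    by (rule inj_lengths_unbounded[OF A inj pl(1)])
  then obtain K where K: "\<And>m k. k \<ge> K m \<Longrightarrow> m + C \<le> length (p k)" by metis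
  have stable: "take m (p k) = take m (p (K m))" if "k \<ge> K m" for m k
    using that
  proof (induction k rule: dec_induct)
    case (step k)
    have "take m (p (Suc k)) = take m (p k)"
      unfolding assms(4) using K[of m k] step(1) assms(5)[of k] pl(2)
      by (intro take_reduce_append) auto
    then show ?case using step by simp
  qed simp
  \<comment> \<open>letter \<open>i\<close> no longer changes from the index \<open>K (Suc i)\<close> on\<close>
  define f where "f i = p (K (Suc i)) ! i" for i
  have f: "p k ! i = f i" if "k \<ge> K m" "i < m" for k m i
  proof -
    let ?k = "max (K m) (K (Suc i))"
    have "p k ! i = take m (p k) ! i" using that by simp
    also have "\<dots> = take m (p ?k) ! i" using stable[OF that(1)] stable[of m ?k] by simp
    also have "\<dots> = take (Suc i) (p ?k) ! i" using that by simp
    also have "\<dots> = f i" using stable[of "Suc i" ?k] by (simp add: f_def)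
    finally show ?thesis .
  qed
  have "tends_to_end p f"
    unfolding tends_to_end_def
  proof
    fix m
    show "\<exists>N. \<forall>k\<ge>N. m \<le> length (p k) \<and> take m (p k) = map f [0..<m]"
    proof (intro exI[of _ "K m"] allI impI conjI)
      fix k assume k: "K m \<le> k"
      show l: "m \<le> length (p k)" using K[OF k] by simp
      show "take m (p k) = map f [0..<m]"
        using l f[OF k] by (intro nth_equalityI) auto
    qed
  qed
  moreover have "f i \<in> letters A" "f (Suc i) \<noteq> linv (f i)" for i
  proof -
    let ?w = "p (K (i + 2))"
    have l: "Suc i < length ?w" using K[of "i + 2" "K (i + 2)"] by simp
    have w: "?w ! i = f i" "?w ! Suc i = f (Suc i)" using f[of "i + 2" "K (i + 2)"] by auto
    show "f i \<in> letters A" using pl(1)[of "K (i + 2)"] l w by (metis Suc_lessD in_lists_conv_set nth_mem)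
    show "f (Suc i) \<noteq> linv (f i)"
      using pl(2)[of "K (i + 2)"] l w by (auto simp: reduced_def successively_conv_nth)
  qed
  ultimately show ?thesis by (auto simp: FG_hat_def)
qed

text \<open>The terms of \<open>q\<close> are distinct, hence long, hence close to late terms of \<open>p\<close>, with which they
  share long prefixes.\<close>

lemma near_sequence_converges:
  assumes A: "finite A" and p: "\<And>k. p k \<in> carrier (FG A)" "tends_to_end p f"
    and q: "\<And>k. q k \<in> carrier (FG A)" "inj q"
    and near: "\<And>k. \<exists>j b. q k = reduce (p j @ b) \<and> length b \<le> C"
  shows "tends_to_end q f"
  unfolding tends_to_end_def
proof
  fix m
  obtain N where N: "\<And>j. j \<ge> N \<Longrightarrow> m + C \<le> length (p j) \<and> take (m + C) (p j) = map f [0..<m + C]"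
    using p(2) unfolding tends_to_end_def by metis
  \<comment> \<open>longer than every word within distance \<open>C\<close> of one of \<open>p 0, ..., p (N - 1)\<close>\<close>
  let ?B = "m + (\<Sum>i<N. length (p i)) + C + 1"
  have ql: "q k \<in> lists (letters A)" for k using q(1)[of k] by (simp add: FG_def)
  obtain K where K: "\<And>k. k \<ge> K \<Longrightarrow> ?B \<le> length (q k)"
    using inj_lengths_unbounded[OF A q(2) ql] by metis
  show "\<exists>K. \<forall>k\<ge>K. m \<le> length (q k) \<and> take m (q k) = map f [0..<m]"
  proof (intro exI[of _ K] allI impI conjI)
    fix k assume k: "K \<le> k"
    show "m \<le> length (q k)" using K[OF k] by simp
    obtain j b where jb: "q k = reduce (p j @ b)" "length b \<le> C" using near by blast
    have "length (q k) \<le> length (p j) + C"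
      using length_reduce_le[of "p j @ b"] jb by simp
    moreover have "length (p j) \<le> (\<Sum>i<N. length (p i))" if "j < N"
      using that by (intro member_le_sum) auto
    ultimately have "j \<ge> N" using K[OF k] by (cases "j < N") auto
    from N[OF this] have j: "m + C \<le> length (p j)" "take (m + C) (p j) = map f [0..<m + C]" by auto
    have "take m (q k) = take m (p j)"
      unfolding jb(1) using j(1) jb(2) p(1)[of j] by (intro take_reduce_append) (auto simp: FG_def)
    also have "\<dots> = take m (take (m + C) (p j))" by simp
    also have "\<dots> = map f [0..<m]" unfolding j(2) by (simp add: take_map)
    finally show "take m (q k) = map f [0..<m]" .
  qed
qed

lemma limitin_end:
  assumes q: "\<And>k. q k \<in> carrier (FG A)" and f: "InfWord f \<in> FG_hat A" and lim: "tends_to_end q f"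
  shows "limitin (FG_hat_top A) (\<lambda>k. FinWord (q k)) (InfWord f) sequentially"
proof -
  interpret Metric_space "FG_hat A" prefix_dist by (rule Metric_space_FG_hat)
  have "\<exists>N. \<forall>k\<ge>N. FinWord (q k) \<in> FG_hat A \<and> prefix_dist (FinWord (q k)) (InfWord f) < e"
    if e: "e > 0" for e
  proof -
    obtain m where m: "(1/2::real) ^ m < e" using real_arch_pow_inv[OF e, of "1/2"] by auto
    obtain K where K: "\<And>k. k \<ge> K \<Longrightarrow> m \<le> length (q k) \<and> take m (q k) = map f [0..<m]"
      using lim unfolding tends_to_end_def by metis
    have "prefix_dist (FinWord (q k)) (InfWord f) < e" if k: "k \<ge> K" for k
    proof -
      have "prefix_of (map f [0..<m]) (FinWord (q k))" using K[OF k] by (metis prefix_of.simps(1) take_is_prefix)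
      moreover have "prefix_of (map f [0..<m]) (InfWord f)" by simp
      ultimately have "m \<le> lcp_length (FinWord (q k)) (InfWord f)"
        using length_le_lcp[of "FinWord (q k)" "InfWord f" "map f [0..<m]"] by simp
      then have "(1/2::real) ^ lcp_length (FinWord (q k)) (InfWord f) \<le> (1/2) ^ m"
        by (intro power_decreasing) auto
      moreover have "prefix_dist (FinWord (q k)) (InfWord f) = (1/2) ^ lcp_length (FinWord (q k)) (InfWord f)"
        by (simp add: prefix_dist_def)
      ultimately show ?thesis using m by linarith
    qed
    then show ?thesis using q by (auto simp: FG_hat_def)
  qed
  then show ?thesis unfolding FG_hat_top_def limit_metric_sequentially using f by blast
qed

section \<open>A pumped family of fixed points has no growing branch\<close>

text \<open>In the free group \<open>u z v = z\<close> says that \<open>v\<close> is the inverse of \<open>u\<close> conjugated by \<open>z\<close>.\<close>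

lemma reduce_conj_wpow:
  "reduce (u @ z @ v) = reduce z \<Longrightarrow> reduce (wpow u j @ z @ wpow v j) = reduce z"
proof (induction j)
  case (Suc j)
  have "reduce (u @ (wpow u j @ z @ wpow v j) @ v) = reduce (u @ z @ v)"
    unfolding reduce_left_cancel reduce_right_cancel using Suc by blast
  then show ?case using Suc.prems by (simp add: wpow_commute)
qed simp

text \<open>The word walks along the ray \<open>x u^j\<close>, makes the detour \<open>z\<close>, and then, as \<open>z v^j\<close> and \<open>u^{-j}
  z\<close> have the same value, walks back parallel to the same ray.\<close>

lemma munn_pumped_near_ray:
  assumes g: "g \<in> munn (x @ wpow u k @ z @ wpow v k @ y)" and zv: "reduce (u @ z @ v) = reduce z"
  shows "\<exists>j b. g = reduce (x @ wpow u j @ b) \<and>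
    length b \<le> length x + length u + length z + length v + length y"
proof -
  obtain q where q: "g = reduce q" "prefix q (x @ wpow u k @ z @ wpow v k @ y)"
    using g by (auto simp: munn_def)
  consider "prefix q x" | r where "q = x @ r" "prefix r (wpow u k)"
    | r where "q = x @ wpow u k @ r" "prefix r z"
    | r where "q = x @ wpow u k @ z @ r" "prefix r (wpow v k)"
    | r where "q = x @ wpow u k @ z @ wpow v k @ r" "prefix r y"
    using q(2) by (auto simp: prefix_append)
  then show ?thesis
  proof cases
    case 1
    then obtain r where r: "x = q @ r" unfolding prefix_def by metis
    have "g = reduce (x @ wpow u 0 @ winv r)" unfolding q(1) r by simp
    moreover have "length (winv r) \<le> length x" unfolding r by (simp add: winv_def)
    ultimately show ?thesis by (intro exI[of _ 0] exI[of _ "winv r"]) auto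
  next
    case 2
    then obtain j r' where "j \<le> k" "prefix r' u" "r = wpow u j @ r'" using prefix_wpow by blast
    then have "g = reduce (x @ wpow u j @ r')" "length r' \<le> length u"
      using 2 q(1) prefix_length_le by auto
    then show ?thesis by (intro exI[of _ j] exI[of _ r']) auto
  next
    case 3
    then have "length r \<le> length z" using prefix_length_le by blast
    then show ?thesis using 3 q(1) by (intro exI[of _ k] exI[of _ r]) auto
  next
    case 4
    then obtain j r' where j: "j \<le> k" "prefix r' v" "r = wpow v j @ r'" using prefix_wpow by blast
    \<comment> \<open>\<open>j\<close> steps back from \<open>x u^k z\<close> lead to \<open>x u^(k - j) z\<close>\<close>
    have "wpow u k = wpow u (k - j) @ wpow u j" using wpow_add[of "k - j" j u] j(1) by simp
    then have "g = reduce ((x @ wpow u (k - j)) @ (wpow u j @ z @ wpow v j) @ r')"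
      using q(1) 4(1) j(3) by simp
    also have "\<dots> = reduce ((x @ wpow u (k - j)) @ z @ r')"
      unfolding reduce_left_cancel reduce_right_cancel using reduce_conj_wpow[OF zv] .
    finally have "g = reduce (x @ wpow u (k - j) @ z @ r')" by simp
    moreover have "length (z @ r') \<le> length x + length u + length z + length v + length y"
      using prefix_length_le[OF j(2)] by simp
    ultimately show ?thesis by blast
  next
    case 5
    have "g = reduce (x @ (wpow u k @ z @ wpow v k) @ r)" using q(1) 5(1) by simp
    also have "\<dots> = reduce (x @ z @ r)"
      unfolding reduce_left_cancel reduce_right_cancel using reduce_conj_wpow[OF zv] .
    finally have "g = reduce (x @ wpow u 0 @ z @ r)" by simp
    moreover have "length (z @ r) \<le> length x + length u + length z + length v + length y"
      using prefix_length_le[OF 5(2)] by simp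
    ultimately show ?thesis by blast
  qed
qed

context fim_endomorphism_inj
begin

text \<open>If \<open>u\<close> were nontrivial, then \<open>p k = x u^k\<close> would converge to an end. Its images under \<open>\<theta>\<close>
  are vertices of the same trees, because these trees are fixed, so they stay near the ray and
  converge to the same end. By continuity that end is fixed by the extension.\<close>

lemma pumped_fixed_points_trivial:
  assumes A: "finite A" and cont: "continuous_extension A \<theta> \<phi>hat"
    and nofix: "\<And>f. InfWord f \<in> FG_hat A \<Longrightarrow> \<phi>hat (InfWord f) \<noteq> InfWord f"
    and L: "\<And>k. x @ wpow u k @ z @ wpow v k @ y \<in> lists (letters A)"
    and fixed: "\<And>k. \<phi> (fim_class A (x @ wpow u k @ z @ wpow v k @ y)) = fim_class A (x @ wpow u k @ z @ wpow v k @ y)"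
    and triv: "\<And>k. reduce (x @ wpow u k @ z @ wpow v k @ y) = []"
  shows "reduce u = []"
proof (rule ccontr)
  assume u: "reduce u \<noteq> []"
  define p where "p k = reduce (x @ wpow u k)" for k
  have xl: "x \<in> lists (letters A)" "u \<in> lists (letters A)" using L[of 1] by auto
  have wl: "x @ wpow u k \<in> lists (letters A)" for k using L[of k] by auto
  have p: "p k \<in> carrier (FG A)" for k unfolding p_def using wl by (rule reduce_in_carrier)
  have inj_p: "inj p" unfolding p_def by (rule inj_reduce_wpow[OF u])
  have step: "p (Suc k) = reduce (p k @ u)" for k
    unfolding p_def reduce_append by (simp add: wpow_commute)
  obtain f where f: "InfWord f \<in> FG_hat A" "tends_to_end p f"
    using bounded_steps_converge[OF A p inj_p step order.refl] by blast
  define q where "q k = \<theta> (p k)" for k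
  have q: "q k \<in> carrier (FG A)" for k unfolding q_def using p by (rule induced_closed)
  have inj_q: "inj q"
  proof (rule injI)
    fix i j assume "q i = q j"
    then have "p i = p j" unfolding q_def by (rule inj_onD[OF inj _ p p])
    then show "i = j" by (rule injD[OF inj_p])
  qed
  have "reduce (x @ (u @ z @ v) @ y) = reduce (x @ z @ y)"
    using triv[of 1] triv[of 0] by simp
  then have zv: "reduce (u @ z @ v) = reduce z" by (simp only: reduce_left_cancel reduce_right_cancel)
  have "\<exists>j b. q k = reduce (p j @ b) \<and> length b \<le> length x + length u + length z + length v + length y" for k
  proof -
    let ?w = "x @ wpow u k @ z @ wpow v k @ y"
    have "p k \<in> munn ?w" unfolding p_def munn_def by (intro imageI) simp
    then have "p k \<in> tree (fim_class A ?w)" unfolding tree_class[OF L] .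
    then have "q k \<in> tree (\<phi> (fim_class A ?w))"
      unfolding q_def by (rule tree_endo[OF class_in_FIM[OF L]])
    then have "q k \<in> munn ?w" unfolding fixed tree_class[OF L] .
    from munn_pumped_near_ray[OF this zv] show ?thesis
      unfolding p_def reduce_append by simp
  qed
  then have "tends_to_end q f" by (rule near_sequence_converges[OF A p f(2) q inj_q])
  then have "limitin (FG_hat_top A) (\<lambda>k. FinWord (q k)) (InfWord f) sequentially"
    by (rule limitin_end[OF q f(1)])
  moreover have "limitin (FG_hat_top A) (\<phi>hat \<circ> (\<lambda>k. FinWord (p k))) (\<phi>hat (InfWord f)) sequentially"
    using cont unfolding continuous_extension_def
    by (intro continuous_map_limit[OF _ limitin_end[OF p f]]) blast
  moreover have "\<phi>hat \<circ> (\<lambda>k. FinWord (p k)) = (\<lambda>k. FinWord (q k))"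
    using cont p unfolding continuous_extension_def q_def by (simp add: fun_eq_iff)
  moreover have "Hausdorff_space (FG_hat_top A)"
    unfolding FG_hat_top_def by (rule Metric_space.Hausdorff_space_mtopology[OF Metric_space_FG_hat])
  ultimately have "\<phi>hat (InfWord f) = InfWord f"
    using limitin_Hausdorff_unique[OF _ _ trivial_limit_sequentially] by metis
  then show False using nofix[OF f(1)] by blast
qed

end

section \<open>Rational and finitely generated sets of idempotents\<close>

lemma finite_classes_of_bounded_trees:
  assumes "finite (\<Union>w\<in>L. munn w)" "L \<subseteq> lists (letters A)"
  shows "finite (fim_class A ` L)"
proof -
  have "fim_class A ` L \<subseteq> {X \<in> carrier (FIM A). tree X \<subseteq> (\<Union>w\<in>L. munn w)}"
  proof
    fix X assume "X \<in> fim_class A ` L"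
    then obtain w where w: "w \<in> L" "X = fim_class A w" by blast
    then have "w \<in> lists (letters A)" using assms(2) by blast
    then show "X \<in> {X \<in> carrier (FIM A). tree X \<subseteq> (\<Union>w\<in>L. munn w)}"
      using w tree_class[of w A] by auto
  qed
  then show ?thesis using finite_FIM_bounded_tree[OF assms(1)] finite_subset by blast
qed

lemma rational_lang_in_lists: "rational_lang \<Sigma> L \<Longrightarrow> L \<subseteq> lists \<Sigma>"
proof (induction rule: rational_lang.induct)
  case (product K L)
  have "u @ v \<in> lists \<Sigma>" if "u \<in> K" "v \<in> L" for u v
    using subsetD[OF product.IH(1) that(1)] subsetD[OF product.IH(2) that(2)] by simp
  then show ?case by blast
next
  case (star L)
  have "w \<in> lists \<Sigma>" if "w \<in> star_lang L" for w
    using that by induction (use star.IH in auto)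
  then show ?case by blast
qed auto

text \<open>Embedding the language between fixed words \<open>x\<close> and \<open>y\<close> is what makes the induction work: for
  a product, the contexts of the factors are enlarged by a word of the other factor, and all words
  of the first factor have the same value. For a star, comparing the context around a word of \<open>L\<close>
  with the context around the empty word shows that the words of \<open>L\<close> have trivial value.\<close>

lemma rational_trivial_bounded_trees:
  assumes "rational_lang \<Sigma> L" "\<And>u. u \<in> L \<Longrightarrow> reduce (x @ u @ y) = []"
  shows "finite (\<Union>w\<in>L. munn w)"
  using assms
proof (induction arbitrary: x y rule: rational_lang.induct)
  case (union K L)
  then have "finite (\<Union>w\<in>K. munn w)" "finite (\<Union>w\<in>L. munn w)" by blast+
  then show ?case by (simp add: UN_Un)
next
  case (product K L)
  show ?case
  proof (cases "K = {} \<or> L = {}")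
    case False
    then obtain k l where kl: "k \<in> K" "l \<in> L" by blast
    have "reduce (x @ u @ (l @ y)) = []" if "u \<in> K" for u
      using product.prems[of "u @ l"] that kl by auto
    then have K: "finite (\<Union>w\<in>K. munn w)" by (rule product.IH(1))
    have "reduce ((x @ k) @ v @ y) = []" if "v \<in> L" for v
      using product.prems[of "k @ v"] that kl by auto
    then have L: "finite (\<Union>w\<in>L. munn w)" by (rule product.IH(2))
    have const: "reduce u = reduce k" if "u \<in> K" for u
    proof -
      have "reduce (x @ u @ l @ y) = reduce (x @ k @ l @ y)"
        using product.prems[of "u @ l"] product.prems[of "k @ l"] that kl by fastforce
      then show ?thesis by (simp only: reduce_left_cancel reduce_right_cancel)
    qed
    have "munn (u @ v) \<subseteq> (\<Union>w\<in>K. munn w) \<union> (\<lambda>g. reduce (k @ g)) ` (\<Union>w\<in>L. munn w)"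
      if "u \<in> K" "v \<in> L" for u v
    proof -
      have "(\<lambda>g. reduce (u @ g)) = (\<lambda>g. reduce (k @ g))"
        using const[OF that(1)] by (simp add: fun_eq_iff)
      then have "munn (u @ v) = munn u \<union> (\<lambda>g. reduce (k @ g)) ` munn v"
        by (simp only: munn_append)
      moreover have "munn u \<subseteq> (\<Union>w\<in>K. munn w)" "munn v \<subseteq> (\<Union>w\<in>L. munn w)"
        using that by (simp_all add: UN_upper)
      ultimately show ?thesis by (metis Un_mono image_mono)
    qed
    then have "(\<Union>w\<in>{u @ v | u v. u \<in> K \<and> v \<in> L}. munn w) \<subseteq>
      (\<Union>w\<in>K. munn w) \<union> (\<lambda>g. reduce (k @ g)) ` (\<Union>w\<in>L. munn w)" by blast
    then show ?thesis by (rule finite_subset) (use K L in simp)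
  qed auto
next
  case (star L)
  have L: "u \<in> star_lang L" if "u \<in> L" for u
    using star_lang.append[OF that star_lang.Nil] by simp
  have fin: "finite (\<Union>w\<in>L. munn w)" using star L by blast
  have triv: "reduce u = []" if "u \<in> L" for u
  proof -
    have "reduce (x @ u @ y) = reduce (x @ [] @ y)"
      using star.prems[OF L[OF that]] star.prems[OF star_lang.Nil] by simp
    then show ?thesis by (simp only: reduce_left_cancel reduce_right_cancel reduce_Nil)
  qed
  have "munn w \<subseteq> insert [] (\<Union>w\<in>L. munn w)" if "w \<in> star_lang L" for w
    using that by induction (auto simp: munn_append_trivial[OF triv])
  then have "(\<Union>w\<in>star_lang L. munn w) \<subseteq> insert [] (\<Union>w\<in>L. munn w)" by blast
  then show ?case by (rule finite_subset) (use fin in simp)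
qed auto

lemma rational_idempotents_finite:
  assumes "rational_subset A X" and triv: "\<And>e. e \<in> X \<Longrightarrow> fim_to_fg e = []"
  shows "finite X"
proof -
  obtain L where L: "rational_lang (letters A) L" "X = fim_class A ` L"
    using assms(1) unfolding rational_subset_def by blast
  have l: "L \<subseteq> lists (letters A)" using L(1) by (rule rational_lang_in_lists)
  have "reduce ([] @ u @ []) = []" if "u \<in> L" for u
    using triv[of "fim_class A u"] that L(2) fim_to_fg_class[OF subsetD[OF l that]] by simp
  then have "finite (\<Union>w\<in>L. munn w)" by (rule rational_trivial_bounded_trees[OF L(1)])
  then show ?thesis unfolding L(2) using l by (rule finite_classes_of_bounded_trees)
qed

text \<open>The tree of a product of idempotents is the union of the trees of the factors.\<close>

lemma fin_gen_idempotents_finite: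
  assumes "fin_gen_submonoid (FIM A) X" and triv: "\<And>e. e \<in> X \<Longrightarrow> fim_to_fg e = []"
  shows "finite X"
proof -
  interpret M: monoid "FIM A" by (rule monoid_FIM)
  obtain S where S: "finite S" "S \<subseteq> X" "submonoid_gen (FIM A) S = X" and X: "submonoid X (FIM A)"
    using assms(1) unfolding fin_gen_submonoid_def by blast
  have carr: "X \<subseteq> carrier (FIM A)" using X by (rule submonoid.subset)
  let ?R = "insert [] (\<Union>e\<in>S. tree e)"
  have "e \<in> X \<and> tree e \<subseteq> ?R" if "e \<in> submonoid_gen (FIM A) S" for e
    using that
  proof induction
    case one
    then show ?case using submonoid.one_closed[OF X] tree_one[of A] by simp
  next
    case (incl e)
    then show ?case using S(2) by auto
  next
    case (mult e f)
    then have ef: "e \<in> carrier (FIM A)" "f \<in> carrier (FIM A)" using carr by auto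
    have "tree (e \<otimes>\<^bsub>FIM A\<^esub> f) = tree e \<union> tree f"
      using tree_mult_trivial[OF ef] triv mult.IH by blast
    then show ?case using mult.IH submonoid.m_closed[OF X] by auto
  qed
  then have "X \<subseteq> {e \<in> carrier (FIM A). tree e \<subseteq> ?R}" using S(3) carr by blast
  moreover have "finite (tree e)" if "e \<in> S" for e
    using that S(2) carr by (intro finite_tree) blast
  then have "finite ?R" using S(1) by simp
  from finite_FIM_bounded_tree[OF this] have "finite {e \<in> carrier (FIM A). tree e \<subseteq> ?R}" .
  ultimately show ?thesis by (rule finite_subset)
qed

section \<open>Derivations and pumping in context-free grammars\<close>

text \<open>Derivations as trees: the second argument is a sentential form, the third its terminal
  yield. Equivalence with the rewriting steps is \<open>derives_iff_cfg_steps\<close>.\<close>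

inductive derives :: "'c production set \<Rightarrow> (nat + 'c) list \<Rightarrow> 'c list \<Rightarrow> bool" for P where
  Nil: "derives P [] []"
| leaf: "derives P \<alpha> z \<Longrightarrow> derives P (Inr c # \<alpha>) (c # z)"
| expand: "(n, w) \<in> P \<Longrightarrow> derives P w u \<Longrightarrow> derives P \<alpha> z \<Longrightarrow> derives P (Inl n # \<alpha>) (u @ z)"

lemma derives_append: "derives P \<alpha> u \<Longrightarrow> derives P \<beta> v \<Longrightarrow> derives P (\<alpha> @ \<beta>) (u @ v)"
  by (induction rule: derives.induct) (auto intro: derives.intros)

lemma derives_appendE:
  assumes "derives P (\<alpha> @ \<beta>) z"
  obtains u v where "z = u @ v" "derives P \<alpha> u" "derives P \<beta> v"
  using assms
proof (induction \<alpha> arbitrary: z thesis)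
  case Nil
  then show ?case using derives.Nil by fastforce
next
  case (Cons s \<alpha>)
  from Cons.prems(2) show ?case
  proof (cases rule: derives.cases)
    case (leaf \<alpha>' z' c)
    then have "derives P (\<alpha> @ \<beta>) z'" by simp
    then obtain u v where "z' = u @ v" "derives P \<alpha> u" "derives P \<beta> v" using Cons.IH by blast
    then show ?thesis using Cons.prems(1)[of "c # u" v] leaf derives.leaf by fastforce
  next
    case (expand n w x \<alpha>' z')
    then have "derives P (\<alpha> @ \<beta>) z'" by simp
    then obtain u v where "z' = u @ v" "derives P \<alpha> u" "derives P \<beta> v" using Cons.IH by blast
    then show ?thesis
      using Cons.prems(1)[of "x @ u" v] expand derives.expand by fastforce
  qed simp
qed

lemma derives_Nil_iff [simp]: "derives P [] z \<longleftrightarrow> z = []"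
  by (auto intro: derives.Nil elim: derives.cases)

lemma derives_Inl_iff: "derives P [Inl n] z \<longleftrightarrow> (\<exists>w. (n, w) \<in> P \<and> derives P w z)"
proof
  assume "derives P [Inl n] z"
  then show "\<exists>w. (n, w) \<in> P \<and> derives P w z"
    by (cases rule: derives.cases) auto
next
  assume "\<exists>w. (n, w) \<in> P \<and> derives P w z"
  then show "derives P [Inl n] z" using derives.expand[OF _ _ derives.Nil] by fastforce
qed

lemma derives_terminals: "derives P (map Inr z) z"
  by (induction z) (auto intro: derives.intros)

lemma cfg_steps_context:
  "(cfg_step P)\<^sup>*\<^sup>* \<alpha> \<beta> \<Longrightarrow> (cfg_step P)\<^sup>*\<^sup>* (x @ \<alpha> @ y) (x @ \<beta> @ y)"
proof (induction rule: rtranclp_induct)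
  case (step \<beta> \<gamma>)
  from step.hyps(2) have "cfg_step P (x @ \<beta> @ y) (x @ \<gamma> @ y)"
  proof cases
    case (1 n w x' y')
    then show ?thesis using cfg_step.intros[of n w P "x @ x'" "y' @ y"] by simp
  qed
  then show ?case using step.IH by simp
qed simp

lemma derives_iff_cfg_steps: "derives P \<alpha> z \<longleftrightarrow> (cfg_step P)\<^sup>*\<^sup>* \<alpha> (map Inr z)"
proof
  show "derives P \<alpha> z \<Longrightarrow> (cfg_step P)\<^sup>*\<^sup>* \<alpha> (map Inr z)"
  proof (induction rule: derives.induct)
    case (leaf \<alpha> z c)
    then show ?case using cfg_steps_context[of P \<alpha> "map Inr z" "[Inr c]" "[]"] by simp
  next
    case (expand n w u \<alpha> z)
    have "cfg_step P (Inl n # \<alpha>) (w @ \<alpha>)"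
      using cfg_step.intros[OF expand.hyps(1), of "[]" \<alpha>] by simp
    moreover have "(cfg_step P)\<^sup>*\<^sup>* (w @ \<alpha>) (map Inr u @ \<alpha>)"
      using cfg_steps_context[OF expand.IH(1), of "[]" \<alpha>] by simp
    moreover have "(cfg_step P)\<^sup>*\<^sup>* (map Inr u @ \<alpha>) (map Inr u @ map Inr z)"
      using cfg_steps_context[OF expand.IH(2), of "map Inr u" "[]"] by simp
    ultimately show ?case by simp
  qed simp
next
  show "(cfg_step P)\<^sup>*\<^sup>* \<alpha> (map Inr z) \<Longrightarrow> derives P \<alpha> z"
  proof (induction rule: converse_rtranclp_induct)
    case base
    show ?case by (rule derives_terminals)
  next
    case (step \<alpha> \<beta>)
    from step.hyps(1) show ?case
    proof cases
      case (1 n w x y)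
      then obtain a b c where "z = a @ b @ c" "derives P x a" "derives P w b" "derives P y c"
        using step.IH by (metis derives_appendE)
      then show ?thesis
        using 1 derives_append derives_Inl_iff by metis
    qed
  qed
qed

lemma derives_in_lists:
  assumes P: "P \<subseteq> UNIV \<times> lists (UNIV <+> \<Sigma>)"
  shows "derives P \<alpha> z \<Longrightarrow> \<alpha> \<in> lists (UNIV <+> \<Sigma>) \<Longrightarrow> z \<in> lists \<Sigma>"
  by (induction rule: derives.induct) (use P in auto)

lemma cfg_lang_eq_derives:
  assumes "P \<subseteq> UNIV \<times> lists (UNIV <+> \<Sigma>)"
  shows "cfg_lang P s \<Sigma> = {w. derives P [Inl s] w}"
  using derives_in_lists[OF assms, of "[Inl s]"] by (auto simp: cfg_lang_def derives_iff_cfg_steps)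

text \<open>Terminal words \<open>x\<close> and \<open>y\<close> with \<open>n \<Rightarrow>\<^sup>* x m y\<close>. The words grow along the path in the
  derivation tree from the root to the leaf \<open>m\<close>.\<close>

inductive yield_context :: "'c production set \<Rightarrow> nat \<Rightarrow> nat \<Rightarrow> 'c list \<Rightarrow> 'c list \<Rightarrow> bool" for P n where
  refl: "yield_context P n n [] []"
| step: "yield_context P n m x y \<Longrightarrow> (m, \<alpha> @ Inl k # \<beta>) \<in> P \<Longrightarrow> derives P \<alpha> a \<Longrightarrow> derives P \<beta> b \<Longrightarrow>
    yield_context P n k (x @ a) (b @ y)"

lemma yield_context_derives:
  "yield_context P n m x y \<Longrightarrow> derives P [Inl m] z \<Longrightarrow> derives P [Inl n] (x @ z @ y)"
proof (induction arbitrary: z rule: yield_context.induct)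
  case (step m x y \<alpha> k \<beta> a b)
  have "derives P (\<alpha> @ [Inl k] @ \<beta>) (a @ z @ b)"
    by (intro derives_append step)
  then have "derives P [Inl m] (a @ z @ b)" using step.hyps(2) derives_Inl_iff by fastforce
  from step.IH[OF this] show ?case by simp
qed simp

lemma yield_context_trans:
  "yield_context P m k u v \<Longrightarrow> yield_context P n m x y \<Longrightarrow> yield_context P n k (x @ u) (v @ y)"
proof (induction rule: yield_context.induct)
  case (step m x y \<alpha> k \<beta> a b)
  then show ?case using yield_context.step by fastforce
qed simp

lemma yield_context_pump:
  assumes "yield_context P s n x y" "yield_context P n n u v" "derives P [Inl n] z"
  shows "derives P [Inl s] (x @ wpow u k @ z @ wpow v k @ y)"
proof -
  have "yield_context P n n (wpow u k) (wpow v k)"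
  proof (induction k)
    case (Suc k)
    show ?case using yield_context_trans[OF assms(2) Suc] by (simp add: wpow_commute)
  qed (simp add: yield_context.refl)
  from yield_context_derives[OF yield_context_trans[OF this assms(1)] assms(3)] show ?thesis by simp
qed

section \<open>Bounded trees from grammars without growing loops\<close>

text \<open>An edge is a triple of source, label and target.\<close>

fun walk :: "('v \<times> 'c list \<times> 'v) set \<Rightarrow> 'v \<Rightarrow> ('v \<times> 'c list \<times> 'v) list \<Rightarrow> 'v \<Rightarrow> bool" where
  "walk E n [] k \<longleftrightarrow> n = k"
| "walk E n (e # es) k \<longleftrightarrow> e \<in> E \<and> fst e = n \<and> walk E (snd (snd e)) es k"

abbreviation walk_label :: "('v \<times> 'c list \<times> 'v) list \<Rightarrow> 'c list" where
  "walk_label es \<equiv> concat (map (fst \<circ> snd) es)"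

lemma walk_append: "walk E n (es @ fs) k \<longleftrightarrow> (\<exists>m. walk E n es m \<and> walk E m fs k)"
  by (induction es arbitrary: n) auto

lemma walk_subset: "walk E n es k \<Longrightarrow> set es \<subseteq> E"
  by (induction es arbitrary: n) auto

lemma remove_trivial_loops:
  assumes loops: "\<And>n es fs. walk E s fs n \<Longrightarrow> walk E n es n \<Longrightarrow> reduce (walk_label es) = []"
  shows "walk E s es k \<Longrightarrow> \<exists>fs. walk E s fs k \<and> distinct (map fst fs) \<and>
    reduce (walk_label fs) = reduce (walk_label es)"
proof (induction "length es" arbitrary: es rule: less_induct)
  case less
  show ?case
  proof (cases "distinct (map fst es)")
    case True
    then show ?thesis using less.prems by blast
  next
    case False
    then obtain xs ys zs n where "map fst es = xs @ [n] @ ys @ [n] @ zs"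
      using not_distinct_decomp by blast
    then obtain es1 e1 es2 e2 es3 where es: "es = es1 @ (e1 # es2) @ e2 # es3" "fst e1 = n" "fst e2 = n"
      by (auto simp: map_eq_append_conv map_eq_Cons_conv append_eq_map_conv Cons_eq_map_conv)
    from less.prems obtain p q where w: "walk E s es1 p" "walk E p (e1 # es2) q" "walk E q (e2 # es3) k"
      unfolding es(1) walk_append by blast
    have pq: "p = n" "q = n" using w(2,3) es(2,3) by auto
    have "reduce (walk_label (e1 # es2)) = []" using loops w pq by blast
    then have "reduce (walk_label es1 @ walk_label (e1 # es2) @ walk_label (e2 # es3)) =
        reduce (walk_label es1 @ [] @ walk_label (e2 # es3))"
      unfolding reduce_left_cancel reduce_right_cancel by simp
    then have lab: "reduce (walk_label es) = reduce (walk_label (es1 @ e2 # es3))"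
      unfolding es(1) by simp
    have "walk E s (es1 @ e2 # es3) k" using w pq unfolding walk_append by blast
    moreover have "length (es1 @ e2 # es3) < length es" unfolding es(1) by simp
    ultimately obtain fs where "walk E s fs k" "distinct (map fst fs)"
      "reduce (walk_label fs) = reduce (walk_label (es1 @ e2 # es3))"
      using less.hyps[of "es1 @ e2 # es3"] by blast
    then show ?thesis unfolding lab by blast
  qed
qed

text \<open>Deleting loops of trivial value leaves a walk that visits every vertex at most once, and
  there are only finitely many of those.\<close>

lemma finite_walk_labels:
  assumes fin: "finite E"
    and loops: "\<And>n es fs. walk E s fs n \<Longrightarrow> walk E n es n \<Longrightarrow> reduce (walk_label es) = []"
  shows "finite {reduce (walk_label es) | es k. walk E s es k}"
proof -
  let ?F = "{es. set es \<subseteq> E \<and> length es \<le> card (fst ` E)}"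
  have "reduce (walk_label es) \<in> (\<lambda>es. reduce (walk_label es)) ` ?F" if w: "walk E s es k" for es k
  proof -
    obtain fs where fs: "walk E s fs k" "distinct (map fst fs)" "reduce (walk_label fs) = reduce (walk_label es)"
      using remove_trivial_loops[of E s es k, OF _ w] loops by blast
    have sub: "set fs \<subseteq> E" using walk_subset[OF fs(1)] .
    have "length fs = card (fst ` set fs)" using distinct_card[OF fs(2)] by simp
    also have "\<dots> \<le> card (fst ` E)" using fin sub by (intro card_mono image_mono finite_imageI)
    finally show ?thesis using sub fs(3) by (metis (mono_tags, lifting) image_eqI mem_Collect_eq)
  qed
  then have "{reduce (walk_label es) | es k. walk E s es k} \<subseteq> (\<lambda>es. reduce (walk_label es)) ` ?F"
    by blast
  then show ?thesis using finite_lists_length_le[OF fin] finite_subset by blast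
qed

text \<open>Every prefix of a word of the language is the left context of some position inside a
  production, reached by a path in the derivation tree. Its value is the product of the left
  context of the nonterminal and of the part of the production to the left of that position. Since
  all words of the language have trivial value, the value of the second part depends only on the
  position, not on the derivation. The value of the first part is the label of a walk in a finite
  graph on the nonterminals. Pumping shows that loops in this graph have trivial value, so there
  are finitely many labels.\<close>

lemma cfg_bounded_trees:
  assumes P: "finite P"
    and triv: "\<And>w. derives P [Inl s] w \<Longrightarrow> reduce w = []"
    and pump: "\<And>x u z v y. (\<And>k. derives P [Inl s] (x @ wpow u k @ z @ wpow v k @ y)) \<Longrightarrow> reduce u = []"
  shows "finite (\<Union>w\<in>{w. derives P [Inl s] w}. munn w)"
proof -
  \<comment> \<open>\<open>a\<close> is a yield of the part \<open>\<alpha>\<close> of a production \<open>m \<rightarrow> \<alpha> \<beta>\<close> that occurs in a complete derivation\<close>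
  define left_of where "left_of m \<alpha> \<beta> a \<longleftrightarrow>
      (\<exists>x y b. yield_context P s m x y \<and> (m, \<alpha> @ \<beta>) \<in> P \<and> derives P \<alpha> a \<and> derives P \<beta> b)"
    for m \<alpha> \<beta> a
  have const: "reduce a = reduce a'" if l: "left_of m \<alpha> \<beta> a" and l': "left_of m \<alpha> \<beta> a'" for m \<alpha> \<beta> a a'
  proof -
    obtain x y b where c: "yield_context P s m x y" "(m, \<alpha> @ \<beta>) \<in> P" "derives P \<alpha> a" "derives P \<beta> b"
      using l unfolding left_of_def by blast
    have a': "derives P \<alpha> a'" using l' unfolding left_of_def by blast
    have "derives P [Inl m] (a @ b)" "derives P [Inl m] (a' @ b)"
      using c a' derives_append derives_Inl_iff by metis+
    then have "reduce (x @ (a @ b) @ y) = []" "reduce (x @ (a' @ b) @ y) = []"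
      using yield_context_derives[OF c(1)] triv by blast+
    then have "reduce (x @ a @ b @ y) = reduce (x @ a' @ b @ y)" by simp
    then show ?thesis by (simp only: reduce_left_cancel reduce_right_cancel)
  qed
  define splits where "splits = (\<Union>(m, w)\<in>P. (\<lambda>i. (m, take i w, drop i w)) ` {..length w})"
  have fin_splits: "finite splits" unfolding splits_def using P by auto
  have in_splits: "(m, \<alpha>, \<beta>) \<in> splits" if "(m, \<alpha> @ \<beta>) \<in> P" for m \<alpha> \<beta>
  proof -
    have "(m, \<alpha>, \<beta>) \<in> (\<lambda>i. (m, take i (\<alpha> @ \<beta>), drop i (\<alpha> @ \<beta>))) ` {..length (\<alpha> @ \<beta>)}"
      by (rule image_eqI[of _ _ "length \<alpha>"]) auto
    then show ?thesis unfolding splits_def by (intro UN_I[OF that]) simp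
  qed
  define val where "val = (\<lambda>(m, \<alpha>, \<beta>). reduce (SOME a. left_of m \<alpha> \<beta> a))"
  have val: "reduce a = val (m, \<alpha>, \<beta>)" if "left_of m \<alpha> \<beta> a" for m \<alpha> \<beta> a
    unfolding val_def using const[OF that] someI[of "left_of m \<alpha> \<beta>", OF that] by auto
  \<comment> \<open>restricting to productive targets \<open>k\<close> makes every loop part of a complete derivation\<close>
  define E where "E = {(m, reduce a, k) | m \<alpha> k \<beta> a z. left_of m \<alpha> (Inl k # \<beta>) a \<and> derives P [Inl k] z}"
  have "E \<subseteq> (\<lambda>(m, \<alpha>, \<beta>). (m, val (m, \<alpha>, \<beta>), case hd \<beta> of Inl k \<Rightarrow> k)) ` splits"
  proof
    fix e assume "e \<in> E"
    then obtain m \<alpha> k \<beta> a where e: "e = (m, reduce a, k)" "left_of m \<alpha> (Inl k # \<beta>) a"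
      unfolding E_def by blast
    then have "(m, \<alpha>, Inl k # \<beta>) \<in> splits" using in_splits unfolding left_of_def by blast
    moreover have "e = (m, val (m, \<alpha>, Inl k # \<beta>), k)" using e val by simp
    ultimately show "e \<in> (\<lambda>(m, \<alpha>, \<beta>). (m, val (m, \<alpha>, \<beta>), case hd \<beta> of Inl k \<Rightarrow> k)) ` splits"
      by (intro rev_image_eqI) auto
  qed
  then have fin_E: "finite E" using fin_splits finite_subset by blast
  have walk_context: "\<exists>x y. yield_context P n m x y \<and> reduce x = reduce (walk_label es)" if "walk E n es m" for n m es
    using that
  proof (induction es arbitrary: n)
    case Nil
    then show ?case using yield_context.refl by (intro exI[of _ "[]"]) auto
  next
    case (Cons e es)
    then obtain g k where e: "e = (n, g, k)" "e \<in> E" "walk E k es m" by (cases e) auto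
    then obtain \<alpha> \<beta> a where a: "g = reduce a" "left_of n \<alpha> (Inl k # \<beta>) a"
      unfolding E_def by blast
    then obtain b where b: "(n, \<alpha> @ Inl k # \<beta>) \<in> P" "derives P \<alpha> a" "derives P (Inl k # \<beta>) b"
      unfolding left_of_def by blast
    then obtain b' where b': "derives P \<beta> b'" by (metis append_Cons append_Nil derives_appendE)
    obtain x y where xy: "yield_context P k m x y" "reduce x = reduce (walk_label es)"
      using Cons.IH e(3) by blast
    have "yield_context P n k a b'"
      using yield_context.step[OF yield_context.refl b(1,2) b'] by simp
    from yield_context_trans[OF xy(1) this] have "yield_context P n m (a @ x) (y @ b')" .
    moreover have "reduce (a @ x) = reduce (walk_label (e # es))"
      using reduce_cong[OF _ xy(2), of a g] a(1) e(1) by (simp add: reduce_reduced)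
    ultimately show ?case by blast
  qed
  have walk_productive: "\<exists>z. derives P [Inl m] z" if "walk E n es m" "es \<noteq> []" for n m es
    using that by (cases es rule: rev_cases) (auto simp: E_def walk_append)
  have loops: "reduce (walk_label es) = []" if w: "walk E s fs n" "walk E n es n" for n es fs
  proof (cases "es = []")
    case False
    then obtain z where z: "derives P [Inl n] z" using walk_productive w(2) by blast
    obtain x y where xy: "yield_context P s n x y" using walk_context[OF w(1)] by blast
    obtain u v where uv: "yield_context P n n u v" "reduce u = reduce (walk_label es)"
      using walk_context[OF w(2)] by blast
    show ?thesis using pump[OF yield_context_pump[OF xy uv(1) z]] uv(2) by simp
  qed simp
  let ?W = "{reduce (walk_label es) | es k. walk E s es k}"
  have fin_W: "finite ?W" by (rule finite_walk_labels[OF fin_E loops])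
  have context_walk: "\<exists>es. walk E s es m \<and> reduce x = reduce (walk_label es)"
    if "yield_context P s m x y" "derives P [Inl m] z" for m x y z
    using that
  proof (induction arbitrary: z rule: yield_context.induct)
    case refl
    show ?case by (intro exI[of _ "[]"]) simp
  next
    case (step m x y \<alpha> k \<beta> a b)
    have d: "derives P ([Inl k] @ \<beta>) (z @ b)" using step.prems step.hyps(4) by (rule derives_append)
    then have l: "left_of m \<alpha> (Inl k # \<beta>) a" using step.hyps unfolding left_of_def by auto
    have "derives P [Inl m] (a @ z @ b)"
      using derives_append[OF step.hyps(3) d] step.hyps(2) derives_Inl_iff by fastforce
    from step.IH[OF this] obtain es where es: "walk E s es m" "reduce x = reduce (walk_label es)" by blast
    have "(m, reduce a, k) \<in> E" unfolding E_def using l step.prems by blast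
    then have "walk E s (es @ [(m, reduce a, k)]) k"
      using es(1) by (simp add: walk_append)
    moreover have "reduce (x @ a) = reduce (walk_label (es @ [(m, reduce a, k)]))"
      using reduce_cong[OF es(2), of a "reduce a"] by (simp add: reduce_reduced)
    ultimately show ?case by blast
  qed
  define R where "R = (\<lambda>(g, h). reduce (g @ h)) ` (?W \<times> val ` splits)"
  have fin_R: "finite R" unfolding R_def using fin_W fin_splits by blast
  have in_R: "reduce (x @ d) \<in> R"
    if h: "yield_context P s m x y" "(m, \<delta> @ \<gamma>) \<in> P" "derives P \<delta> d" "derives P \<gamma> c" for m x y \<delta> \<gamma> d c
  proof -
    have "derives P [Inl m] (d @ c)" using derives_append[OF h(3,4)] h(2) derives_Inl_iff by metis
    then obtain es where es: "walk E s es m" "reduce x = reduce (walk_label es)"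
      using context_walk[OF h(1)] by blast
    have "left_of m \<delta> \<gamma> d" unfolding left_of_def using h by blast
    then have v: "val (m, \<delta>, \<gamma>) = reduce d" using val by metis
    have "reduce (x @ d) = reduce (walk_label es @ d)" using es(2) by (simp only: reduce_right_cancel)
    also have "\<dots> = reduce (reduce (walk_label es) @ val (m, \<delta>, \<gamma>))" unfolding v reduce_append by (rule HOL.refl)
    finally have eq: "reduce (x @ d) = reduce (reduce (walk_label es) @ val (m, \<delta>, \<gamma>))" .
    have "(reduce (walk_label es), val (m, \<delta>, \<gamma>)) \<in> ?W \<times> val ` splits"
      using es(1) in_splits[OF h(2)] by blast
    then show ?thesis unfolding R_def eq by (rule rev_image_eqI) simp
  qed
  \<comment> \<open>Here \<open>\<gamma>\<close> is the unread rest of a production; \<open>x\<close> and \<open>d\<close> were read before it. The induction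
    moves the position through the production and down into its nonterminals.\<close>
  have prefixes: "reduce (x @ d @ p) \<in> R"
    if "derives P \<gamma> c" "yield_context P s m x y" "(m, \<delta> @ \<gamma>) \<in> P" "derives P \<delta> d" "prefix p c"
    for \<gamma> c m x y \<delta> d p
    using that
  proof (induction arbitrary: m x y \<delta> d p rule: derives.induct)
    case Nil
    then show ?case using in_R[OF Nil(1,2,3) derives.Nil] by simp
  next
    case (leaf \<gamma> c t)
    show ?case
    proof (cases p)
      case Nil
      then show ?thesis using in_R[OF leaf.prems(1,2,3) derives.leaf[OF leaf.hyps]] by simp
    next
      case (Cons t' p')
      then have p: "p = t # p'" "prefix p' c" using leaf.prems(4) by auto
      have "derives P (\<delta> @ [Inr t]) (d @ [t])"
        using derives_append[OF leaf.prems(3) derives_terminals[of P "[t]"]] by simp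
      then show ?thesis
        using leaf.IH[OF leaf.prems(1), of "\<delta> @ [Inr t]" "d @ [t]" p'] leaf.prems(2) p by simp
    qed
  next
    case (expand k w u \<gamma> c)
    consider "prefix p u" | p' where "p = u @ p'" "prefix p' c"
      using expand.prems(4) by (auto simp: prefix_append)
    then show ?case
    proof cases
      case 1
      have "yield_context P s k (x @ d) (c @ y)"
        using yield_context.step[OF expand.prems(1,2,3) expand.hyps(3)] .
      from expand.IH(1)[OF this, of "[]" "[]" p] show ?thesis
        using expand.hyps(1) 1 derives.Nil by simp
    next
      case 2
      have "derives P [Inl k] u" using expand.hyps derives_Inl_iff by metis
      from derives_append[OF expand.prems(3) this]
      show ?thesis
        using expand.IH(2)[OF expand.prems(1), of "\<delta> @ [Inl k]" "d @ u" p'] expand.prems(2) 2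
        by simp
    qed
  qed
  have "munn c \<subseteq> R" if "derives P [Inl s] c" for c
  proof -
    obtain w where "(s, w) \<in> P" "derives P w c" using \<open>derives P [Inl s] c\<close> derives_Inl_iff by metis
    then show ?thesis
      using prefixes[OF _ yield_context.refl, of w c "[]" "[]"] derives.Nil by (auto simp: munn_def)
  qed
  then have "(\<Union>w\<in>{w. derives P [Inl s] w}. munn w) \<subseteq> R" by auto
  then show ?thesis using fin_R by (rule finite_subset)
qed

section \<open>Finite sets are context-free and rational\<close>

lemma derives_Inr_iff: "derives P (Inr c # \<alpha>) z \<longleftrightarrow> (\<exists>z'. z = c # z' \<and> derives P \<alpha> z')"
  by (auto intro: derives.leaf elim: derives.cases)

lemma derives_map_Inr_iff: "derives P (map Inr w) z \<longleftrightarrow> z = w"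
  by (induction w arbitrary: z) (auto simp: derives_Inr_iff)

lemma finite_imp_context_free:
  assumes "finite L" "L \<subseteq> lists \<Sigma>"
  shows "context_free_lang \<Sigma> L"
proof -
  let ?P = "(\<lambda>w. (0 :: nat, map Inr w)) ` L"
  have P: "?P \<subseteq> UNIV \<times> lists (UNIV <+> \<Sigma>)" using assms(2) by fastforce
  have "cfg_lang ?P 0 \<Sigma> = L"
    unfolding cfg_lang_eq_derives[OF P] derives_Inl_iff by (auto simp: derives_map_Inr_iff)
  then show ?thesis unfolding context_free_lang_def using P assms(1) by blast
qed

lemma finite_subset_of_FIM:
  assumes "finite X" "X \<subseteq> carrier (FIM A)"
  shows "context_free_subset A X" "rational_subset A X"
proof -
  obtain L where L: "L \<subseteq> lists (letters A)" "finite L" "X = fim_class A ` L"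
    using assms finite_subset_image[of X "fim_class A" "lists (letters A)"] carrier_FIM by metis
  show "context_free_subset A X"
    unfolding context_free_subset_def using L finite_imp_context_free by blast
  show "rational_subset A X"
    unfolding rational_subset_def using L rational_lang.finite by blast
qed

section \<open>The equivalences\<close>

context fim_endomorphism_inj
begin

lemma context_free_fixpoints_finite:
  assumes A: "finite A" and cont: "continuous_extension A \<theta> \<phi>hat"
    and nofix: "\<And>f. InfWord f \<in> FG_hat A \<Longrightarrow> \<phi>hat (InfWord f) \<noteq> InfWord f"
    and triv: "\<And>X. X \<in> fixpoints (carrier (FIM A)) \<phi> \<Longrightarrow> fim_to_fg X = []"
    and cf: "context_free_subset A (fixpoints (carrier (FIM A)) \<phi>)"
  shows "finite (fixpoints (carrier (FIM A)) \<phi>)"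
proof -
  let ?Fix = "fixpoints (carrier (FIM A)) \<phi>"
  obtain L where L: "context_free_lang (letters A) L" "?Fix = fim_class A ` L"
    using cf unfolding context_free_subset_def by blast
  obtain P s where P: "finite P" "P \<subseteq> UNIV \<times> lists (UNIV <+> letters A)"
    and LP: "L = cfg_lang P s (letters A)"
    using L(1) unfolding context_free_lang_def by blast
  have Ld: "L = {w. derives P [Inl s] w}" unfolding LP by (rule cfg_lang_eq_derives[OF P(2)])
  have word: "w \<in> lists (letters A)" "\<phi> (fim_class A w) = fim_class A w" "reduce w = []" if "derives P [Inl s] w" for w
  proof -
    have "w \<in> L" using that unfolding Ld by blast
    then show l: "w \<in> lists (letters A)" unfolding LP cfg_lang_def by blast
    have f: "fim_class A w \<in> ?Fix" using L(2) \<open>w \<in> L\<close> by blast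
    then show "\<phi> (fim_class A w) = fim_class A w" by (simp add: fixpoints_def)
    show "reduce w = []" using triv[OF f] fim_to_fg_class[OF l] by simp
  qed
  have "finite (\<Union>w\<in>{w. derives P [Inl s] w}. munn w)"
  proof (rule cfg_bounded_trees[OF P(1) word(3)])
    fix x u z v y :: "'a word"
    assume d: "derives P [Inl s] (x @ wpow u k @ z @ wpow v k @ y)" for k
    show "reduce u = []"
      by (rule pumped_fixed_points_trivial[OF A cont nofix word(1)[OF d] word(2)[OF d] word(3)[OF d]])
  qed
  moreover have "L \<subseteq> lists (letters A)" using word(1) Ld by blast
  ultimately show ?thesis unfolding L(2) using finite_classes_of_bounded_trees Ld by metis
qed

lemma submonoid_fixpoints: "submonoid (fixpoints (carrier (FIM A)) \<phi>) (FIM A)"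
  by standard (auto simp: fixpoints_def hom_mult[OF hom] one)

end

theorem theorem3p10:
  fixes A :: "'a set"
    and \<phi> :: "'a word set \<Rightarrow> 'a word set"
    and \<phi>hat :: "'a bword \<Rightarrow> 'a bword"
  assumes "finite A"
    and "\<phi> \<in> hom (FIM A) (FIM A)" and "\<phi> \<one>\<^bsub>FIM A\<^esub> = \<one>\<^bsub>FIM A\<^esub>"
    and "inj_on (fg_induced A \<phi>) (carrier (FG A))"
    and "continuous_extension A (fg_induced A \<phi>) \<phi>hat"
    and "fixpoints (FG_hat A) \<phi>hat = {FinWord \<one>\<^bsub>FG A\<^esub>}"
  shows "(context_free_subset A (fixpoints (carrier (FIM A)) \<phi>)
           \<longleftrightarrow> rational_subset A (fixpoints (carrier (FIM A)) \<phi>))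
       \<and> (rational_subset A (fixpoints (carrier (FIM A)) \<phi>)
           \<longleftrightarrow> fin_gen_submonoid (FIM A) (fixpoints (carrier (FIM A)) \<phi>))
       \<and> (fin_gen_submonoid (FIM A) (fixpoints (carrier (FIM A)) \<phi>)
           \<longleftrightarrow> finite (fixpoints (carrier (FIM A)) \<phi>))
       \<and> (finite (fixpoints (carrier (FIM A)) \<phi>)
           \<longleftrightarrow> finite (perpoints (carrier (FIM A)) \<phi>))
       \<and> (finite (perpoints (carrier (FIM A)) \<phi>)
           \<longleftrightarrow> perpoints (carrier (FIM A)) \<phi> \<subseteq> idempotents (FIM A))"
proof -
  interpret fim_endomorphism_inj A \<phi>
    by unfold_locales (use assms in auto)
  let ?Fix = "fixpoints (carrier (FIM A)) \<phi>" and ?Per = "perpoints (carrier (FIM A)) \<phi>"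
  have nofix: "\<phi>hat (InfWord f) \<noteq> InfWord f" if "InfWord f \<in> FG_hat A" for f
    using assms(6) that by (auto simp: fixpoints_def)
  have triv: "fim_to_fg X = []" if X: "X \<in> ?Fix" for X
  proof -
    have Xc: "X \<in> carrier (FIM A)" "\<phi> X = X" using X by (auto simp: fixpoints_def)
    have g: "fim_to_fg X \<in> carrier (FG A)" using hom_in_carrier[OF fim_to_fg_hom Xc(1)] .
    have "\<phi>hat (FinWord (fim_to_fg X)) = FinWord (fim_to_fg X)"
      using assms(5) g fg_endo[OF Xc(1)] Xc(2) by (simp add: continuous_extension_def)
    then have "FinWord (fim_to_fg X) \<in> fixpoints (FG_hat A) \<phi>hat"
      using g by (auto simp: fixpoints_def FG_hat_def)
    then show ?thesis using assms(6) by (simp add: FG_def)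
  qed
  have carr: "?Fix \<subseteq> carrier (FIM A)" by (auto simp: fixpoints_def)
  have fin_cf: "finite ?Fix \<longleftrightarrow> context_free_subset A ?Fix"
    using context_free_fixpoints_finite[OF assms(1,5) nofix triv] finite_subset_of_FIM(1)[OF _ carr]
    by blast
  have fin_rat: "finite ?Fix \<longleftrightarrow> rational_subset A ?Fix"
    using rational_idempotents_finite[OF _ triv] finite_subset_of_FIM(2)[OF _ carr] by blast
  have "submonoid_gen (FIM A) ?Fix \<subseteq> ?Fix"
  proof
    fix X assume "X \<in> submonoid_gen (FIM A) ?Fix"
    then show "X \<in> ?Fix"
      by induction (use submonoid_fixpoints in \<open>auto intro: submonoid.one_closed submonoid.m_closed\<close>)
  qed
  then have "submonoid_gen (FIM A) ?Fix = ?Fix"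
    by (rule subset_antisym) (rule subsetI, rule submonoid_gen.incl)
  then have "finite ?Fix \<Longrightarrow> fin_gen_submonoid (FIM A) ?Fix"
    unfolding fin_gen_submonoid_def by (intro conjI submonoid_fixpoints exI[of _ ?Fix]) simp_all
  then have fin_fg: "finite ?Fix \<longleftrightarrow> fin_gen_submonoid (FIM A) ?Fix"
    using fin_gen_idempotents_finite[OF _ triv] by blast
  have "?Fix \<subseteq> ?Per" by (auto simp: perpoints_iff fixpoints_def intro!: exI[of _ "Suc 0"])
  then have per_fix: "finite ?Per \<Longrightarrow> finite ?Fix" by (rule finite_subset)
  have idem_per: "finite ?Per" if "?Per \<subseteq> idempotents (FIM A)"
    using per_idempotent_imp_trivial[OF that] by (rule finite_subset) simp
  show ?thesis
    using fin_cf fin_rat fin_fg per_fix idem_per finite_fix_imp_per_idempotent by argo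
qed

end
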